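(* Let $D$ be the circle of radius $1$ centered at the origin of $\mathbb R^2$, with the metric inherited from $\mathbb R^2$, and let $\eta$ be Lebesgue (arc length) measure on $D$, so $\eta(D)=2\pi$. Then, for all sufficiently large $\rho$, the $2$-player Cox process Hotelling game $(D,\eta,\frac{\rho}{2},\frac{\rho}{2})$ is not an ordinal potential game.
   Context: For $r>0$, $\mathcal C(r)=\{f:D\to\mathbb R_+ \text{ measurable}: \int_D f\,d\eta=r\}$ (functions equal $\eta$-a.e. are identified). For a point process $\Phi$ on $D$ (with metric $d$) and a point $x$ in its support, the open Voronoi cell is $W_\Phi(x)=\{z\in D: d(x,z)<d(x',z)\text{ for all points }x'\neq x\text{ in the support of }\Phi\}$. In the $2$-player Cox process Hotelling game $(D,\eta,\rho_A,\rho_B)$, Alice's pure actions are the elements $f_A\in\mathcal C(\rho_A)$ and Bob's are the elements $f_B\in\mathcal C(\rho_B)$. Given $(f_A,f_B)$, let $\Phi_A,\Phi_B$ be independent Poisson point processes on $D$ with intensity measures $f_A\eta$ and $f_B\eta$, and $\Phi=\Phi_A+\Phi_B$. The values are $V_A(f_A,f_B)=\mathbb E[\sum_{x\in\Phi_A}\eta(W_\Phi(x))]$ and $V_B(f_A,f_B)=\mathbb E[\sum_{x\in\Phi_B}\eta(W_\Phi(x))]$ (an empty sum is $0$). An $n$-player game in which player $i$ has action set $\mathcal Y_i$ and value function $V_i$ is an ordinal potential game if there is a function $P:\prod_{i=1}^n\mathcal Y_i\to\mathbb R$ such that for all $1\le i\le n$, all $y_i,z_i\in\mathcal Y_i$ and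 all $(y_j,j\ne i)\in\prod_{j\ne i}\mathcal Y_j$: $V_i(y_i,(y_j,j\ne i))>V_i(z_i,(y_j,j\ne i))$ if and only if $P(y_i,(y_j,j\ne i))>P(z_i,(y_j,j\ne i))$. Here the action sets are the sets of pure actions. *)

theory Defs
  imports "HOL-Probability.Probability" "HOL-Library.Multiset"
begin

text \<open>Games. A strategy profile is a function on the player set \<open>{1..n}\<close>.\<close>

definition ordinal_potential_game ::
    "nat \<Rightarrow> (nat \<Rightarrow> 'y set) \<Rightarrow> (nat \<Rightarrow> (nat \<Rightarrow> 'y) \<Rightarrow> real) \<Rightarrow> bool" where
  "ordinal_potential_game n Y V \<longleftrightarrow>
     (\<exists>P :: (nat \<Rightarrow> 'y) \<Rightarrow> real.
        \<forall>i\<in>{1..n}. \<forall>y\<in>PiE {1..n} Y. \<forall>a\<in>Y i. \<forall>b\<in>Y i.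
          V i (y(i := a)) > V i (y(i := b)) \<longleftrightarrow> P (y(i := a)) > P (y(i := b)))"


text \<open>Point processes. All intensity measures below are finite, so a realization of a point process
  is almost surely a finite configuration of points with multiplicities, encoded as a multiset.
  The configuration space carries the sigma-algebra generated by the counts of measurable sets.\<close>

definition num_points :: "'a set \<Rightarrow> 'a multiset \<Rightarrow> nat" where
  "num_points B \<phi> = size (filter_mset (\<lambda>x. x \<in> B) \<phi>)"

definition config_space :: "'a measure \<Rightarrow> 'a multiset measure" where
  "config_space \<mu> =
     sigma {\<phi>. set_mset \<phi> \<subseteq> space \<mu>}
           {{\<phi>. set_mset \<phi> \<subseteq> space \<mu> \<and> num_points B \<phi> = k} | B k. B \<in> sets \<mu>}"

definition poisson_point_process ::
    "'w measure \<Rightarrow> 'a measure \<Rightarrow> ('w \<Rightarrow> 'a multiset) \<Rightarrow> bool" where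
  "poisson_point_process M \<mu> \<Phi> \<longleftrightarrow>
     prob_space M \<and> finite_measure \<mu> \<and> \<Phi> \<in> measurable M (config_space \<mu>) \<and>
     (\<forall>B\<in>sets \<mu>. \<forall>k.
        measure M {\<omega> \<in> space M. num_points B (\<Phi> \<omega>) = k} =
        exp (- measure \<mu> B) * measure \<mu> B ^ k / fact k) \<and>
     (\<forall>m. \<forall>B :: nat \<Rightarrow> 'a set.
        (\<forall>i<m. B i \<in> sets \<mu>) \<and> disjoint_family_on B {..<m} \<longrightarrow>
        prob_space.indep_vars M (\<lambda>_. count_space UNIV) (\<lambda>i \<omega>. num_points (B i) (\<Phi> \<omega>)) {..<m})"

text \<open>The law of a Poisson point process with finite intensity measure \<open>\<mu>\<close>: by the existence and
  uniqueness theorem, exactly one measure on the configuration space makes the identity such a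
  process.\<close>

definition poisson_law :: "'a measure \<Rightarrow> 'a multiset measure" where
  "poisson_law \<mu> =
     (THE P. sets P = sets (config_space \<mu>) \<and> poisson_point_process P \<mu> (\<lambda>\<phi>. \<phi>))"


text \<open>The Cox process Hotelling game. The underlying set \<open>D\<close> is \<open>space \<eta>\<close>, and its metric is the
  one inherited from the ambient type.\<close>

definition voronoi_cell :: "'a::metric_space set \<Rightarrow> 'a multiset \<Rightarrow> 'a \<Rightarrow> 'a set" where
  "voronoi_cell D \<phi> x = {z \<in> D. \<forall>x'\<in>set_mset \<phi>. x' \<noteq> x \<longrightarrow> dist x z < dist x' z}"

text \<open>The expected total mass of the cells of the points of the first process, in the Voronoi
  tessellation of the superposition of two independent Poisson processes with intensity measures
  \<open>f\<eta>\<close> and \<open>g\<eta>\<close>.\<close>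

definition expected_share :: "'a::metric_space measure \<Rightarrow> ('a \<Rightarrow> real) \<Rightarrow> ('a \<Rightarrow> real) \<Rightarrow> real" where
  "expected_share \<eta> f g =
     (\<integral>\<omega>. (\<Sum>x\<in>#fst \<omega>. measure \<eta> (voronoi_cell (space \<eta>) (fst \<omega> + snd \<omega>) x))
        \<partial>(poisson_law (density \<eta> (\<lambda>x. ennreal (f x))) \<Otimes>\<^sub>M
           poisson_law (density \<eta> (\<lambda>x. ennreal (g x)))))"

definition intensities :: "'a measure \<Rightarrow> real \<Rightarrow> ('a \<Rightarrow> real) set" where
  "intensities \<eta> r =
     {f \<in> borel_measurable \<eta>. (\<forall>x\<in>space \<eta>. 0 \<le> f x) \<and> (\<integral>\<^sup>+x. ennreal (f x) \<partial>\<eta>) = ennreal r}"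

text \<open>Actions are classes of almost everywhere equal intensities. The values do not depend on the
  chosen representatives, because the measures \<open>f\<eta>\<close> do not.\<close>

definition cox_actions :: "'a measure \<Rightarrow> real \<Rightarrow> ('a \<Rightarrow> real) set set" where
  "cox_actions \<eta> r =
     intensities \<eta> r //
       {(f, g). f \<in> intensities \<eta> r \<and> g \<in> intensities \<eta> r \<and> (AE x in \<eta>. f x = g x)}"

definition representative :: "('a \<Rightarrow> real) set \<Rightarrow> 'a \<Rightarrow> real" where
  "representative F = (SOME f. f \<in> F)"

text \<open>Alice is player 1 and Bob is player 2.\<close>

definition hotelling_actions ::
    "'a measure \<Rightarrow> real \<Rightarrow> real \<Rightarrow> nat \<Rightarrow> ('a \<Rightarrow> real) set set" where
  "hotelling_actions \<eta> \<rho>A \<rho>B i = cox_actions \<eta> (if i = 1 then \<rho>A else \<rho>B)"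

definition hotelling_value ::
    "'a::metric_space measure \<Rightarrow> nat \<Rightarrow> (nat \<Rightarrow> ('a \<Rightarrow> real) set) \<Rightarrow> real" where
  "hotelling_value \<eta> i F =
     (if i = 1 then expected_share \<eta> (representative (F 1)) (representative (F 2))
      else expected_share \<eta> (representative (F 2)) (representative (F 1)))"


definition circle_measure :: "(real ^ 2) measure" where
  "circle_measure =
     distr (restrict_space lborel {0..<2 * pi}) (restrict_space borel (sphere 0 1))
       (\<lambda>t. vector [cos t, sin t])"

end

theory Submission
  imports Defs "HOL-Combinatorics.Multiset_Permutations" "HOL-Real_Asymp.Real_Asymp"
begin

text \<open>
The proof exhibits a cycle of improving moves in the style of matching pennies. Say that a player
clusters at a point of the circle when the whole intensity is concentrated on a short arc around that
point, and flanks a point when the intensity is concentrated on two short arcs, one on either side of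
the point at a small angle. Let Alice cluster at one of two antipodal points and let Bob flank one of
the same two points. If Bob flanks the point where Alice clusters, her cells are squeezed between his
two groups and he gets at least five sixths of the circle. If Bob flanks the antipodal point, his two
groups are close together on the far side, and Alice gets at least a quarter of the circle. Hence Bob
always wants to move to Alice's point, Alice always wants to move away, and the four profiles form a
cycle along which an ordinal potential would have to increase forever
(\<open>not_ordinal_potential_game_cycle\<close>).

Only lower bounds on shares are computed (\<open>flanks_beat_cluster\<close>, \<open>opposite_cluster_share\<close>). They hold as
soon as all the arcs concerned contain a point, which has probability tending to one as the intensity
grows. The matching upper bounds follow because the two shares sum to at most the length of the circle
(\<open>expected_share_add_le\<close>); the guaranteed fractions \<open>5/6\<close> and \<open>1/4\<close> sum to more than one, and that
leaves room for the exceptional event.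

These estimates need the Poisson law itself. It is unique because the laws of all discretizations of a
configuration are prescribed (\<open>poisson_law_unique\<close>), and it exists because a Poisson number of independent
points has the required counts (\<open>poisson_point_process_sampling_law\<close>). The share must also be measurable
in the pair of configurations. It is a limit of shares of discretized configurations, since the mass of
a Voronoi cell is continuous in the points as long as bisectors are null (\<open>share_measurable\<close>).
\<close>

section \<open>Configurations and the uniqueness of the Poisson law\<close>

lemma space_config_space: "space (config_space \<mu>) = {\<phi>. set_mset \<phi> \<subseteq> space \<mu>}"
  unfolding config_space_def by (rule space_measure_of) auto

lemma sets_config_space:
  "sets (config_space \<mu>) = sigma_sets {\<phi>. set_mset \<phi> \<subseteq> space \<mu>}
     {{\<phi>. set_mset \<phi> \<subseteq> space \<mu> \<and> num_points B \<phi> = k} | B k. B \<in> sets \<mu>}"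
  unfolding config_space_def by (rule sets_measure_of) auto

lemma config_space_cong:
  "sets \<mu> = sets \<nu> \<Longrightarrow> config_space \<mu> = config_space \<nu>"
  unfolding config_space_def using sets_eq_imp_space_eq[of \<mu> \<nu>] by simp

lemma num_points_measurable:
  assumes "B \<in> sets \<mu>"
  shows "num_points B \<in> measurable (config_space \<mu>) (count_space UNIV)"
proof -
  have "{\<phi>. set_mset \<phi> \<subseteq> space \<mu> \<and> num_points B \<phi> = k} \<in> sets (config_space \<mu>)" for k
    unfolding sets_config_space using assms by (intro sigma_sets.Basic) blast
  moreover have "num_points B -` {k} \<inter> space (config_space \<mu>)
      = {\<phi>. set_mset \<phi> \<subseteq> space \<mu> \<and> num_points B \<phi> = k}" for k
    by (auto simp: space_config_space)
  ultimately show ?thesis by (auto simp: measurable_count_space_eq2_countable)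
qed

lemma count_image_mset_num_points:
  "set_mset \<phi> \<subseteq> S \<Longrightarrow> count (image_mset h \<phi>) j = num_points (h -` {j} \<inter> S) \<phi>"
  by (induction \<phi>) (auto simp: num_points_def)

lemma countable_msets_over: 
  assumes "countable A" shows "countable {m. set_mset m \<subseteq> A}"
proof -
  have "{m. set_mset m \<subseteq> A} \<subseteq> mset ` lists A"
  proof
    fix m assume "m \<in> {m. set_mset m \<subseteq> A}"
    moreover obtain xs where "mset xs = m" using ex_mset by blast
    ultimately show "m \<in> mset ` lists A" by (auto intro!: image_eqI[of _ _ xs])
  qed
  with assms show ?thesis by (meson countable_image countable_lists countable_subset)
qed

lemma image_mset_measurable:
  assumes h: "h \<in> measurable \<mu> (count_space J)" and J: "finite J"
  shows "image_mset h \<in> measurable (config_space \<mu>) (count_space {m. set_mset m \<subseteq> J})"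
proof (subst measurable_count_space_eq_countable)
  show "countable {m. set_mset m \<subseteq> J}" using J by (intro countable_msets_over countable_finite)
  have hJ: "h x \<in> J" if "x \<in> space \<mu>" for x using measurable_space[OF h that] by simp
  have "image_mset h -` {m} \<inter> space (config_space \<mu>) \<in> sets (config_space \<mu>)"
    if m: "set_mset m \<subseteq> J" for m
  proof -
    have "image_mset h -` {m} \<inter> space (config_space \<mu>)
        = {\<phi> \<in> space (config_space \<mu>). \<forall>j\<in>J. num_points (h -` {j} \<inter> space \<mu>) \<phi> = count m j}"
      (is "_ = ?R")
    proof (intro set_eqI iffI)
      fix \<phi> assume "\<phi> \<in> image_mset h -` {m} \<inter> space (config_space \<mu>)"
      then show "\<phi> \<in> ?R"
        by (auto simp: space_config_space count_image_mset_num_points[symmetric])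
    next
      fix \<phi> assume \<phi>: "\<phi> \<in> ?R"
      then have s: "set_mset \<phi> \<subseteq> space \<mu>" by (auto simp: space_config_space)
      have "count (image_mset h \<phi>) j = count m j" for j
      proof (cases "j \<in> J")
        case True then show ?thesis using \<phi> s by (simp add: count_image_mset_num_points)
      next
        case False
        have "j \<notin># image_mset h \<phi>" using False s hJ by auto
        moreover have "j \<notin># m" using False m by auto
        ultimately show ?thesis by (metis not_in_iff)
      qed
      then have "image_mset h \<phi> = m" by (rule multiset_eqI)
      then show "\<phi> \<in> image_mset h -` {m} \<inter> space (config_space \<mu>)" using \<phi> by auto
    qed
    also have "\<dots> \<in> sets (config_space \<mu>)"
    proof -
      have [measurable]: "num_points (h -` {j} \<inter> space \<mu>) \<in> measurable (config_space \<mu>) (count_space UNIV)" if "j \<in> J" for j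
        using measurable_sets[OF h, of "{j}"] that by (intro num_points_measurable) auto
      show ?thesis using J by measurable
    qed
    finally show ?thesis .
  qed
  then show "image_mset h \<in> space (config_space \<mu>) \<rightarrow> {m. set_mset m \<subseteq> J} \<and>
    (\<forall>a\<in>{m. set_mset m \<subseteq> J}. image_mset h -` {a} \<inter> space (config_space \<mu>) \<in> sets (config_space \<mu>))"
    using hJ by (auto simp: space_config_space; blast)
qed

text \<open>The events that depend only on a discretization \<open>image_mset h \<phi>\<close> of the configuration, where \<open>h\<close>
labels the points by finitely many natural numbers. The counts of arbitrary sets do not form a family
that is closed under intersection; these events do, because two labellings can be merged into one by
pairing, and they generate the same sigma-algebra.\<close>

definition discretized_events :: "'a measure \<Rightarrow> 'a multiset set set" where
  "discretized_events \<mu> =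
     {{\<phi>. set_mset \<phi> \<subseteq> space \<mu> \<and> image_mset h \<phi> \<in> A} | (h :: 'a \<Rightarrow> nat) K A.
        h \<in> measurable \<mu> (count_space {..<K})}"

lemma Int_stable_discretized_events: "Int_stable (discretized_events \<mu>)"
proof (rule Int_stableI)
  fix a b assume "a \<in> discretized_events \<mu>" "b \<in> discretized_events \<mu>"
  then obtain h1 h2 :: "'a \<Rightarrow> nat" and K1 K2 A1 A2 where
    h: "h1 \<in> measurable \<mu> (count_space {..<K1})" "h2 \<in> measurable \<mu> (count_space {..<K2})"
    and ab: "a = {\<phi>. set_mset \<phi> \<subseteq> space \<mu> \<and> image_mset h1 \<phi> \<in> A1}"
      "b = {\<phi>. set_mset \<phi> \<subseteq> space \<mu> \<and> image_mset h2 \<phi> \<in> A2}"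
    unfolding discretized_events_def by blast
  define h where "h = (\<lambda>x. prod_encode (h1 x, h2 x))"
  define K where "K = Suc (Max (prod_encode ` ({..<K1} \<times> {..<K2})))"
  have "(\<lambda>p. prod_encode p) \<in> measurable (count_space ({..<K1} \<times> {..<K2})) (count_space {..<K})"
    by (auto simp: K_def less_Suc_eq_le)
  moreover have "(\<lambda>x. (h1 x, h2 x)) \<in> measurable \<mu> (count_space ({..<K1} \<times> {..<K2}))"
    using measurable_Pair[OF h] by (simp add: pair_measure_countable)
  ultimately have "h \<in> measurable \<mu> (count_space {..<K})"
    unfolding h_def by (rule measurable_compose_rev)
  moreover have "image_mset (fst \<circ> prod_decode) (image_mset h \<phi>) = image_mset h1 \<phi>"
    "image_mset (snd \<circ> prod_decode) (image_mset h \<phi>) = image_mset h2 \<phi>" for \<phi>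
    by (simp_all add: h_def multiset.map_comp o_def)
  then have "a \<inter> b = {\<phi>. set_mset \<phi> \<subseteq> space \<mu> \<and> image_mset h \<phi> \<in>
      {m. image_mset (fst \<circ> prod_decode) m \<in> A1 \<and> image_mset (snd \<circ> prod_decode) m \<in> A2}}"
    unfolding ab by auto
  ultimately show "a \<inter> b \<in> discretized_events \<mu>" unfolding discretized_events_def by blast
qed

lemma discretized_eventI:
  fixes h :: "'a \<Rightarrow> nat"
  assumes "h \<in> measurable \<mu> (count_space {..<K})"
  shows "{\<phi>. set_mset \<phi> \<subseteq> space \<mu> \<and> image_mset h \<phi> \<in> A} \<in> discretized_events \<mu>"
  using assms unfolding discretized_events_def by blast

lemma sets_config_space_discretized:
  "sets (config_space \<mu>) = sigma_sets {\<phi>. set_mset \<phi> \<subseteq> space \<mu>} (discretized_events \<mu>)"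
proof
  show "sets (config_space \<mu>) \<subseteq> sigma_sets {\<phi>. set_mset \<phi> \<subseteq> space \<mu>} (discretized_events \<mu>)"
    unfolding sets_config_space
  proof (rule sigma_sets_mono, safe)
    fix B k assume B: "B \<in> sets \<mu>"
    define h :: "'a \<Rightarrow> nat" where "h = (\<lambda>x. if x \<in> B then 1 else 0)"
    have "h -` X \<inter> space \<mu> \<in> sets \<mu>" for X
    proof -
      have "h -` X \<inter> space \<mu> = (if 1 \<in> X then B else {}) \<union> (if 0 \<in> X then space \<mu> - B else {})"
        using sets.sets_into_space[OF B] by (auto simp: h_def split: if_splits)
      then show ?thesis using B by simp
    qed
    then have "h \<in> measurable \<mu> (count_space {..<2})"
      by (auto simp: measurable_def h_def indicator_def)
    moreover have "num_points B \<phi> = count (image_mset h \<phi>) 1" for \<phi>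
      by (induction \<phi>) (auto simp: num_points_def h_def indicator_def)
    then have "{\<phi>. set_mset \<phi> \<subseteq> space \<mu> \<and> num_points B \<phi> = k} =
       {\<phi>. set_mset \<phi> \<subseteq> space \<mu> \<and> image_mset h \<phi> \<in> {m. count m 1 = k}}" by auto
    ultimately show "{\<phi>. set_mset \<phi> \<subseteq> space \<mu> \<and> num_points B \<phi> = k}
       \<in> sigma_sets {\<phi>. set_mset \<phi> \<subseteq> space \<mu>} (discretized_events \<mu>)"
      by (simp only:) (intro sigma_sets.Basic discretized_eventI)
  qed
  have "discretized_events \<mu> \<subseteq> sets (config_space \<mu>)"
  proof
    fix a assume "a \<in> discretized_events \<mu>"
    then obtain h :: "'a \<Rightarrow> nat" and K A where
      h: "h \<in> measurable \<mu> (count_space {..<K})"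
      and a: "a = {\<phi>. set_mset \<phi> \<subseteq> space \<mu> \<and> image_mset h \<phi> \<in> A}"
      unfolding discretized_events_def by blast
    have hs: "set_mset \<phi> \<subseteq> space \<mu> \<Longrightarrow> set_mset (image_mset h \<phi>) \<subseteq> {..<K}" for \<phi>
      using measurable_space[OF h] by auto
    have "image_mset h -` (A \<inter> {m. set_mset m \<subseteq> {..<K}}) \<inter> space (config_space \<mu>) \<in> sets (config_space \<mu>)"
      by (rule measurable_sets[OF image_mset_measurable[OF h]]) auto
    also have "image_mset h -` (A \<inter> {m. set_mset m \<subseteq> {..<K}}) \<inter> space (config_space \<mu>) = a"
      unfolding a space_config_space using hs by auto
    finally show "a \<in> sets (config_space \<mu>)" .
  qed
  from sets.sigma_sets_subset[OF this]
  show "sigma_sets {\<phi>. set_mset \<phi> \<subseteq> space \<mu>} (discretized_events \<mu>) \<subseteq> sets (config_space \<mu>)"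
    by (simp add: space_config_space)
qed

text \<open>The cells of a labelling are disjoint, so the defining properties of a Poisson process fix the law of
every discretization.\<close>

lemma poisson_point_process_image_mset:
  fixes h :: "'a \<Rightarrow> nat"
  assumes P: "poisson_point_process P \<mu> (\<lambda>\<phi>. \<phi>)" and S: "sets P = sets (config_space \<mu>)"
    and h: "h \<in> measurable \<mu> (count_space {..<K})" and m: "set_mset m \<subseteq> {..<K}"
  shows "measure P {\<phi> \<in> space P. image_mset h \<phi> = m} =
    (\<Prod>j<K. exp (- measure \<mu> (h -` {j} \<inter> space \<mu>)) *
       measure \<mu> (h -` {j} \<inter> space \<mu>) ^ count m j / fact (count m j))"
proof -
  interpret prob_space P using P unfolding poisson_point_process_def by blast
  have sp: "space P = {\<phi>. set_mset \<phi> \<subseteq> space \<mu>}"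
    using sets_eq_imp_space_eq[OF S] by (simp add: space_config_space)
  define B where "B j = h -` {j} \<inter> space \<mu>" for j
  have B: "\<forall>i<K. B i \<in> sets \<mu>" using h unfolding B_def by (auto intro: measurable_sets)
  have "disjoint_family_on B {..<K}" by (auto simp: disjoint_family_on_def B_def)
  with P B have ind: "indep_vars (\<lambda>_. count_space UNIV) (\<lambda>i \<phi>. num_points (B i) \<phi>) {..<K}"
    unfolding poisson_point_process_def by blast
  have E: "{\<phi> \<in> space P. image_mset h \<phi> = m} = {\<phi> \<in> space P. \<forall>i<K. num_points (B i) \<phi> = count m i}"
  proof (intro set_eqI iffI)
    fix \<phi> assume "\<phi> \<in> {\<phi> \<in> space P. image_mset h \<phi> = m}"
    then show "\<phi> \<in> {\<phi> \<in> space P. \<forall>i<K. num_points (B i) \<phi> = count m i}"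
      by (auto simp: sp B_def count_image_mset_num_points[symmetric])
  next
    fix \<phi> assume a: "\<phi> \<in> {\<phi> \<in> space P. \<forall>i<K. num_points (B i) \<phi> = count m i}"
    then have s: "set_mset \<phi> \<subseteq> space \<mu>" by (auto simp: sp)
    have "count (image_mset h \<phi>) j = count m j" for j
    proof (cases "j < K")
      case True then show ?thesis using a by (simp add: count_image_mset_num_points[OF s] B_def)
    next
      case False
      have "j \<notin># image_mset h \<phi>" using False s measurable_space[OF h] by auto
      moreover have "j \<notin># m" using False m by auto
      ultimately show ?thesis by (metis not_in_iff)
    qed
    then show "\<phi> \<in> {\<phi> \<in> space P. image_mset h \<phi> = m}" using a by (auto intro: multiset_eqI)
  qed
  show ?thesis
  proof (cases "K = 0")
    case True
    then have "{\<phi> \<in> space P. image_mset h \<phi> = m} = space P" unfolding E by auto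
    then show ?thesis using True by (simp add: prob_space)
  next
    case False
    have "measure P {\<phi> \<in> space P. image_mset h \<phi> = m} =
        measure P (\<Inter>i\<in>{..<K}. (\<lambda>\<phi>. num_points (B i) \<phi>) -` {count m i} \<inter> space P)"
      unfolding E by (rule arg_cong[of _ _ "measure P"]) (use False in auto)
    also have "\<dots> = (\<Prod>i<K. measure P ((\<lambda>\<phi>. num_points (B i) \<phi>) -` {count m i} \<inter> space P))"
      using False by (intro indep_varsD[OF ind]) auto
    also have "\<dots> = (\<Prod>i<K. exp (- measure \<mu> (B i)) * measure \<mu> (B i) ^ count m i / fact (count m i))"
    proof (intro prod.cong refl)
      fix i assume "i \<in> {..<K}"
      moreover have "(\<lambda>\<phi>. num_points (B i) \<phi>) -` {count m i} \<inter> space P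
        = {\<phi> \<in> space P. num_points (B i) \<phi> = count m i}" by auto
      ultimately show "measure P ((\<lambda>\<phi>. num_points (B i) \<phi>) -` {count m i} \<inter> space P)
         = exp (- measure \<mu> (B i)) * measure \<mu> (B i) ^ count m i / fact (count m i)"
        using P B unfolding poisson_point_process_def by simp
    qed
    finally show ?thesis unfolding B_def .
  qed
qed

lemma poisson_law_unique:
  assumes P: "poisson_point_process P \<mu> (\<lambda>\<phi>. \<phi>)" "sets P = sets (config_space \<mu>)"
    and Q: "poisson_point_process Q \<mu> (\<lambda>\<phi>. \<phi>)" "sets Q = sets (config_space \<mu>)"
  shows "P = Q"
proof (rule measure_eqI_generator_eq[OF Int_stable_discretized_events, where \<Omega>="{\<phi>. set_mset \<phi> \<subseteq> space \<mu>}"])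
  interpret P: prob_space P using P unfolding poisson_point_process_def by blast
  interpret Q: prob_space Q using Q unfolding poisson_point_process_def by blast
  have sp: "space P = {\<phi>. set_mset \<phi> \<subseteq> space \<mu>}" "space Q = {\<phi>. set_mset \<phi> \<subseteq> space \<mu>}"
    using sets_eq_imp_space_eq[OF P(2)] sets_eq_imp_space_eq[OF Q(2)] by (simp_all add: space_config_space)
  show "discretized_events \<mu> \<subseteq> Pow {\<phi>. set_mset \<phi> \<subseteq> space \<mu>}"
    unfolding discretized_events_def by auto
  show "sets P = sigma_sets {\<phi>. set_mset \<phi> \<subseteq> space \<mu>} (discretized_events \<mu>)"
    "sets Q = sigma_sets {\<phi>. set_mset \<phi> \<subseteq> space \<mu>} (discretized_events \<mu>)"
    using P Q sets_config_space_discretized by metis+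
  show "range (\<lambda>_::nat. {\<phi>. set_mset \<phi> \<subseteq> space \<mu>}) \<subseteq> discretized_events \<mu>"
    using discretized_eventI[of "\<lambda>_. 0" \<mu> 1 UNIV] by auto
  show "(\<Union>i::nat. {\<phi>. set_mset \<phi> \<subseteq> space \<mu>}) = {\<phi>. set_mset \<phi> \<subseteq> space \<mu>}" by simp
  show "emeasure P {\<phi>. set_mset \<phi> \<subseteq> space \<mu>} \<noteq> \<infinity>" by simp
  fix a assume "a \<in> discretized_events \<mu>"
  then obtain h :: "'a \<Rightarrow> nat" and K A where
      h: "h \<in> measurable \<mu> (count_space {..<K})"
      and a: "a = {\<phi>. set_mset \<phi> \<subseteq> space \<mu> \<and> image_mset h \<phi> \<in> A}"
      unfolding discretized_events_def by blast
  let ?C = "{m. set_mset m \<subseteq> {..<K}}"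
  have hm: "image_mset h \<in> measurable P (count_space ?C)" "image_mset h \<in> measurable Q (count_space ?C)"
    using image_mset_measurable[OF h] measurable_cong_sets[OF P(2) refl] measurable_cong_sets[OF Q(2) refl] by auto
  have "distr P (count_space ?C) (image_mset h) = distr Q (count_space ?C) (image_mset h)"
  proof (rule measure_eqI_countable)
    show "countable ?C" by (intro countable_msets_over) auto
    fix m assume m: "m \<in> ?C"
    have e: "emeasure (distr R (count_space ?C) (image_mset h)) {m} = emeasure R {\<phi> \<in> space R. image_mset h \<phi> = m}"
      if "image_mset h \<in> measurable R (count_space ?C)" for R
      using that m by (subst emeasure_distr) (auto intro!: arg_cong[of _ _ "emeasure R"])
    show "emeasure (distr P (count_space ?C) (image_mset h)) {m} = emeasure (distr Q (count_space ?C) (image_mset h)) {m}"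
      unfolding e[OF hm(1)] e[OF hm(2)] P.emeasure_eq_measure Q.emeasure_eq_measure
      using poisson_point_process_image_mset[OF P h] poisson_point_process_image_mset[OF Q h] m by simp
  qed auto
  then have "emeasure (distr P (count_space ?C) (image_mset h)) (A \<inter> ?C)
     = emeasure (distr Q (count_space ?C) (image_mset h)) (A \<inter> ?C)" by simp
  moreover have "image_mset h -` (A \<inter> ?C) \<inter> space P = a" "image_mset h -` (A \<inter> ?C) \<inter> space Q = a"
    unfolding a sp using measurable_space[OF h] by auto
  ultimately show "emeasure P a = emeasure Q a"
    by (simp add: emeasure_distr hm)
qed

section \<open>Construction of the Poisson law\<close>

text \<open>A Poisson distributed number \<open>n\<close> and, independently of it, an infinite sequence of independent points
with the normalized intensity measure as their law: the first \<open>n\<close> points of the sequence form a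
Poisson process. Carrying the whole sequence keeps the sample space a product.\<close>

definition poisson_sampling :: "'a measure \<Rightarrow> (nat \<times> (nat \<Rightarrow> 'a)) measure" where
  "poisson_sampling \<mu> =
     measure_pmf (poisson_pmf (measure \<mu> (space \<mu>))) \<Otimes>\<^sub>M
     (\<Pi>\<^sub>M i\<in>UNIV. uniform_measure \<mu> (space \<mu>))"

definition sampled_points :: "nat \<times> (nat \<Rightarrow> 'a) \<Rightarrow> 'a multiset" where
  "sampled_points \<omega> = mset (map (snd \<omega>) [0..<fst \<omega>])"

definition poisson_sampling_law :: "'a measure \<Rightarrow> 'a multiset measure" where
  "poisson_sampling_law \<mu> = distr (poisson_sampling \<mu>) (config_space \<mu>) sampled_points"

lemma poisson_weights_sums: "(\<lambda>k. exp (- x) * x ^ k / fact k) sums (1::real)"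
proof -
  have "(\<lambda>k. exp (- x) * (x ^ k /\<^sub>R fact k)) sums (exp (- x) * exp x)"
    by (intro sums_mult exp_converges)
  then show ?thesis by (simp add: mult_exp_exp divide_inverse ac_simps scaleR_conv_of_real)
qed

text \<open>A null intensity is excluded because it cannot be normalized to a law of a sampled point.\<close>

locale nonzero_finite_measure = finite_measure \<mu> for \<mu> :: "'a measure" +
  assumes nonzero: "measure \<mu> (space \<mu>) \<noteq> 0"
begin

abbreviation "mass \<equiv> measure \<mu> (space \<mu>)"
abbreviation "\<nu> \<equiv> uniform_measure \<mu> (space \<mu>)"
abbreviation "samples \<equiv> (\<Pi>\<^sub>M i\<in>(UNIV::nat set). \<nu>)"

lemma mass_pos: "0 < mass" using nonzero by (simp add: less_le)

lemma emeasure_space_nonzero: "emeasure \<mu> (space \<mu>) \<noteq> 0"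
  using nonzero by (auto simp: measure_def)

lemma prob_\<nu>: "prob_space \<nu>"
  by (intro prob_space_uniform_measure emeasure_space_nonzero) simp

lemma measure_\<nu>: "B \<in> sets \<mu> \<Longrightarrow> measure \<nu> B = measure \<mu> B / mass"
  using emeasure_space_nonzero sets.sets_into_space by (subst measure_uniform_measure) (auto simp: Int_absorb1)

sublocale samples: product_prob_space "\<lambda>_::nat. \<nu>" UNIV
proof -
  interpret prob_space \<nu> by (rule prob_\<nu>)
  show "product_prob_space (\<lambda>_::nat. \<nu>)" by unfold_locales
qed

lemma space_sampling: "space (poisson_sampling \<mu>) = UNIV \<times> space samples"
  unfolding poisson_sampling_def by (simp add: space_pair_measure)

lemma sets_sampling: "sets (poisson_sampling \<mu>) = sets (count_space UNIV \<Otimes>\<^sub>M samples)"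
  unfolding poisson_sampling_def by (intro sets_pair_measure_cong) auto

lemma prob_sampling: "prob_space (poisson_sampling \<mu>)"
proof -
  interpret pair_prob_space "measure_pmf (poisson_pmf mass)" samples
    by unfold_locales
  show ?thesis unfolding poisson_sampling_def by unfold_locales
qed

lemma measure_sampling_Times:
  assumes "X \<in> sets samples"
  shows "measure (poisson_sampling \<mu>) ({n} \<times> X) = exp (- mass) * mass ^ n / fact n * measure samples X"
proof -
  have "emeasure (poisson_sampling \<mu>) ({n} \<times> X) = emeasure (measure_pmf (poisson_pmf mass)) {n} * emeasure samples X"
    unfolding poisson_sampling_def using assms by (intro samples.P.emeasure_pair_measure_Times) auto
  then show ?thesis using mass_pos
    by (simp add: measure_def enn2real_mult emeasure_pmf_single)
qed

lemma sampled_points_space: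
  "\<omega> \<in> space (poisson_sampling \<mu>) \<Longrightarrow> set_mset (sampled_points \<omega>) \<subseteq> space \<mu>"
  by (auto simp: space_sampling sampled_points_def space_PiM PiE_iff)

lemma sampled_points_measurable: "sampled_points \<in> measurable (poisson_sampling \<mu>) (config_space \<mu>)"
  unfolding config_space_def
proof (rule measurable_measure_of)
  show "sampled_points \<in> space (poisson_sampling \<mu>) \<rightarrow> {\<phi>. set_mset \<phi> \<subseteq> space \<mu>}"
    using sampled_points_space by auto
  fix Y assume "Y \<in> {{\<phi>. set_mset \<phi> \<subseteq> space \<mu> \<and> num_points B \<phi> = k} | B k. B \<in> sets \<mu>}"
  then obtain B k where B: "B \<in> sets \<mu>"
    and Y: "Y = {\<phi>. set_mset \<phi> \<subseteq> space \<mu> \<and> num_points B \<phi> = k}" by blast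
  have [measurable]: "B \<in> sets \<nu>" using B by simp
  have "(\<lambda>X. num_points B (mset (map X [0..<n]))) \<in> measurable samples (count_space UNIV)" for n
  proof (induction n)
    case 0 then show ?case by (simp add: num_points_def)
  next
    case (Suc n)
    note [measurable] = Suc
    have "(\<lambda>X. num_points B (mset (map X [0..<Suc n])))
       = (\<lambda>X. num_points B (mset (map X [0..<n])) + (if X n \<in> B then 1 else 0))"
      by (auto simp: num_points_def)
    also have "\<dots> \<in> measurable samples (count_space UNIV)" by measurable
    finally show ?case .
  qed
  then have "(\<lambda>\<omega>. num_points B (sampled_points \<omega>)) \<in> measurable (count_space UNIV \<Otimes>\<^sub>M samples) (count_space UNIV)"
    unfolding sampled_points_def by (intro measurable_pair_measure_countable1) auto
  from measurable_sets[OF this, of "{k}"]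
  have "(\<lambda>\<omega>. num_points B (sampled_points \<omega>)) -` {k} \<inter> space (poisson_sampling \<mu>) \<in> sets (poisson_sampling \<mu>)"
    by (simp add: sets_sampling space_sampling space_pair_measure)
  also have "(\<lambda>\<omega>. num_points B (sampled_points \<omega>)) -` {k} \<inter> space (poisson_sampling \<mu>)
      = sampled_points -` Y \<inter> space (poisson_sampling \<mu>)"
    unfolding Y using sampled_points_space by auto
  finally show "sampled_points -` Y \<inter> space (poisson_sampling \<mu>) \<in> sets (poisson_sampling \<mu>)" .
qed auto

lemma measure_samples_labels:
  assumes h: "h \<in> measurable \<mu> (count_space J)" and "finite J" and xs: "set xs \<subseteq> J"
  shows "{X \<in> space samples. \<forall>i<length xs. h (X i) = xs ! i} \<in> sets samples"
    and "measure samples {X \<in> space samples. \<forall>i<length xs. h (X i) = xs ! i}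
       = (\<Prod>x\<in>#mset xs. measure \<mu> (h -` {x} \<inter> space \<mu>) / mass)"
proof -
  have E: "{X \<in> space samples. \<forall>i<length xs. h (X i) = xs ! i}
     = {X \<in> space samples. \<forall>i\<in>{..<length xs}. X i \<in> h -` {xs ! i} \<inter> space \<mu>}"
    by (auto simp: space_PiM PiE_iff)
  have B: "h -` {xs ! i} \<inter> space \<mu> \<in> sets \<mu>" if "i < length xs" for i
    using that xs by (intro measurable_sets[OF h]) (auto dest: nth_mem)
  then have B': "h -` {xs ! i} \<inter> space \<mu> \<in> sets \<nu>" if "i < length xs" for i
    using that by simp
  note [measurable] = B'
  show "{X \<in> space samples. \<forall>i<length xs. h (X i) = xs ! i} \<in> sets samples"
    unfolding E by measurable
  have "emeasure samples {X \<in> space samples. \<forall>i\<in>{..<length xs}. X i \<in> h -` {xs ! i} \<inter> space \<mu>}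
     = (\<Prod>i<length xs. emeasure \<nu> (h -` {xs ! i} \<inter> space \<mu>))"
    using B' by (intro samples.emeasure_PiM_Collect) auto
  also have "\<dots> = ennreal (\<Prod>i<length xs. measure \<nu> (h -` {xs ! i} \<inter> space \<mu>))"
    by (simp add: samples.M.emeasure_eq_measure prod_ennreal)
  finally have "measure samples {X \<in> space samples. \<forall>i<length xs. h (X i) = xs ! i}
     = (\<Prod>i<length xs. measure \<nu> (h -` {xs ! i} \<inter> space \<mu>))"
    unfolding E by (simp add: measure_def prod_nonneg)
  also have "\<dots> = (\<Prod>i<length xs. measure \<mu> (h -` {xs ! i} \<inter> space \<mu>) / mass)"
    using B by (intro prod.cong refl measure_\<nu>) auto
  also have "\<dots> = (\<Prod>x\<leftarrow>xs. measure \<mu> (h -` {x} \<inter> space \<mu>) / mass)"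
    by (simp add: prod.list_conv_set_nth atLeast0LessThan)
  also have "\<dots> = (\<Prod>x\<in>#mset xs. measure \<mu> (h -` {x} \<inter> space \<mu>) / mass)"
    by (simp flip: prod_mset_prod_list)
  finally show "measure samples {X \<in> space samples. \<forall>i<length xs. h (X i) = xs ! i}
       = (\<Prod>x\<in>#mset xs. measure \<mu> (h -` {x} \<inter> space \<mu>) / mass)" .
qed

text \<open>The thinning computation. Given the number \<open>n\<close> of points, a label multiset \<open>m\<close> of size \<open>n\<close> arises from
each of its orderings, and an ordering has probability \<open>\<Prod>j. (\<Lambda> j / mass) ^ count m j\<close>. There are
\<open>n! / (\<Prod>j. (count m j)!)\<close> orderings, so the Poisson weight of \<open>n\<close> cancels the factors \<open>n!\<close> and \<open>mass ^ n\<close>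
and leaves a product of Poisson weights, one for each label.\<close>

lemma measure_sampled_labels:
  assumes h: "h \<in> measurable \<mu> (count_space J)" and J: "finite J" and m: "set_mset m \<subseteq> J"
  shows "measure (poisson_sampling \<mu>) {\<omega> \<in> space (poisson_sampling \<mu>). image_mset h (sampled_points \<omega>) = m}
    = (\<Prod>j\<in>J. exp (- measure \<mu> (h -` {j} \<inter> space \<mu>)) *
         measure \<mu> (h -` {j} \<inter> space \<mu>) ^ count m j / fact (count m j))"
proof -
  define \<Lambda> where "\<Lambda> j = measure \<mu> (h -` {j} \<inter> space \<mu>)" for j
  define n where "n = size m"
  define L where "L xs = {X \<in> space samples. \<forall>i<length xs. h (X i) = xs ! i}" for xs
  have len: "length xs = n" "set xs \<subseteq> J" if "xs \<in> permutations_of_multiset m" for xs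
    using permutations_of_multisetD[OF that] m by (auto simp: n_def)
  have L: "L xs \<in> sets samples" "measure samples (L xs) = (\<Prod>x\<in>#m. \<Lambda> x / mass)"
    if "xs \<in> permutations_of_multiset m" for xs
    using measure_samples_labels[OF h J len(2)[OF that]]
    unfolding L_def \<Lambda>_def permutations_of_multisetD[OF that] by blast+
  have ev: "{\<omega> \<in> space (poisson_sampling \<mu>). image_mset h (sampled_points \<omega>) = m}
      = {n} \<times> (\<Union>xs\<in>permutations_of_multiset m. L xs)"
  proof (intro set_eqI iffI)
    fix \<omega> assume a: "\<omega> \<in> {\<omega> \<in> space (poisson_sampling \<mu>). image_mset h (sampled_points \<omega>) = m}"
    obtain k X where \<omega>: "\<omega> = (k, X)" by fastforce
    have eq: "mset (map (\<lambda>i. h (X i)) [0..<k]) = m"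
      using a by (simp add: \<omega> sampled_points_def multiset.map_comp o_def)
    then have "k = n" by (auto simp: n_def)
    moreover have "map (\<lambda>i. h (X i)) [0..<k] \<in> permutations_of_multiset m"
      using eq by (rule permutations_of_multisetI)
    moreover have "X \<in> L (map (\<lambda>i. h (X i)) [0..<k])"
      using a by (auto simp: L_def \<omega> space_sampling)
    ultimately show "\<omega> \<in> {n} \<times> (\<Union>xs\<in>permutations_of_multiset m. L xs)" unfolding \<omega> by blast
  next
    fix \<omega> assume "\<omega> \<in> {n} \<times> (\<Union>xs\<in>permutations_of_multiset m. L xs)"
    then obtain X xs where \<omega>: "\<omega> = (n, X)" and xs: "xs \<in> permutations_of_multiset m" and X: "X \<in> L xs"
      by blast
    have "map (\<lambda>i. h (X i)) [0..<n] = xs"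
      using X len(1)[OF xs] by (auto simp: L_def intro: nth_equalityI)
    moreover have "image_mset h (sampled_points \<omega>) = mset (map (\<lambda>i. h (X i)) [0..<n])"
      by (simp add: \<omega> sampled_points_def multiset.map_comp o_def)
    ultimately have "image_mset h (sampled_points \<omega>) = m"
      using permutations_of_multisetD[OF xs] by simp
    then show "\<omega> \<in> {\<omega> \<in> space (poisson_sampling \<mu>). image_mset h (sampled_points \<omega>) = m}"
      using X by (auto simp: \<omega> space_sampling L_def)
  qed
  have disj: "disjoint_family_on L (permutations_of_multiset m)"
  proof (unfold disjoint_family_on_def, intro ballI impI)
    fix xs ys assume xy: "xs \<in> permutations_of_multiset m" "ys \<in> permutations_of_multiset m" "xs \<noteq> ys"
    have "xs = ys" if "X \<in> L xs" "X \<in> L ys" for X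
      using that len(1)[OF xy(1)] len(1)[OF xy(2)] by (intro nth_equalityI) (auto simp: L_def)
    then show "L xs \<inter> L ys = {}" using xy by blast
  qed
  have "measure samples (\<Union>xs\<in>permutations_of_multiset m. L xs)
     = (\<Sum>xs\<in>permutations_of_multiset m. measure samples (L xs))"
    using L disj by (intro samples.P.finite_measure_finite_Union) auto
  also have "\<dots> = card (permutations_of_multiset m) * (\<Prod>x\<in>#m. \<Lambda> x / mass)"
    using L by simp
  also have "(\<Prod>x\<in>#m. \<Lambda> x / mass) = (\<Prod>j\<in>J. (\<Lambda> j / mass) ^ count m j)"
    unfolding image_prod_mset_multiplicity using J m by (intro prod.mono_neutral_left) (auto simp: not_in_iff)
  also have "\<dots> = (\<Prod>j\<in>J. \<Lambda> j ^ count m j) / mass ^ n"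
  proof -
    have "n = (\<Sum>j\<in>J. count m j)" unfolding n_def size_multiset_overloaded_eq
      using J m by (intro sum.mono_neutral_left) (auto simp: not_in_iff)
    then show ?thesis by (simp add: power_divide prod_dividef power_sum)
  qed
  finally have U: "measure samples (\<Union>xs\<in>permutations_of_multiset m. L xs)
     = card (permutations_of_multiset m) * ((\<Prod>j\<in>J. \<Lambda> j ^ count m j) / mass ^ n)" .
  have "real (card (permutations_of_multiset m)) * (\<Prod>j\<in>J. fact (count m j)) = fact n"
  proof -
    have "(\<Prod>j\<in>J. fact (count m j)) = (\<Prod>j\<in>set_mset m. fact (count m j) :: nat)"
      using J m by (intro prod.mono_neutral_right) (auto simp: not_in_iff)
    then have "card (permutations_of_multiset m) * (\<Prod>j\<in>J. fact (count m j)) = (fact n :: nat)"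
      using card_permutations_of_multiset_aux[of m] by (simp add: n_def)
    from arg_cong[OF this, of real] show ?thesis by simp
  qed
  then have card: "real (card (permutations_of_multiset m)) / fact n = 1 / (\<Prod>j\<in>J. fact (count m j))"
    using J by (simp add: divide_eq_eq eq_divide_eq prod_zero_iff mult.commute)
  have mass: "mass = (\<Sum>j\<in>J. \<Lambda> j)"
  proof -
    have "space \<mu> = (\<Union>j\<in>J. h -` {j} \<inter> space \<mu>)" using measurable_space[OF h] by auto
    then have "mass = measure \<mu> (\<Union>j\<in>J. h -` {j} \<inter> space \<mu>)" by simp
    also have "\<dots> = (\<Sum>j\<in>J. \<Lambda> j)" unfolding \<Lambda>_def
      using J h by (intro finite_measure_finite_Union) (auto simp: disjoint_family_on_def intro!: measurable_sets[OF h])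
    finally show ?thesis .
  qed
  have "measure (poisson_sampling \<mu>) ({n} \<times> (\<Union>xs\<in>permutations_of_multiset m. L xs))
     = exp (- mass) * mass ^ n / fact n * measure samples (\<Union>xs\<in>permutations_of_multiset m. L xs)"
    using L by (intro measure_sampling_Times) auto
  also have "\<dots> = exp (- mass) * (real (card (permutations_of_multiset m)) / fact n) * (\<Prod>j\<in>J. \<Lambda> j ^ count m j)"
    unfolding U using nonzero by simp
  also have "\<dots> = exp (- mass) * (\<Prod>j\<in>J. \<Lambda> j ^ count m j) / (\<Prod>j\<in>J. fact (count m j))"
    unfolding card by simp
  also have "exp (- mass) = (\<Prod>j\<in>J. exp (- \<Lambda> j))"
    using J by (simp add: mass sum_negf[symmetric] exp_sum)
  finally show ?thesis unfolding ev \<Lambda>_def[symmetric] by (simp add: prod.distrib prod_dividef)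
qed

lemma prob_sampling_law: "prob_space (poisson_sampling_law \<mu>)"
  unfolding poisson_sampling_law_def
  by (intro prob_space.prob_space_distr prob_sampling sampled_points_measurable)

lemma sets_sampling_law: "sets (poisson_sampling_law \<mu>) = sets (config_space \<mu>)"
  by (simp add: poisson_sampling_law_def)

lemma space_sampling_law: "space (poisson_sampling_law \<mu>) = {\<phi>. set_mset \<phi> \<subseteq> space \<mu>}"
  by (simp add: poisson_sampling_law_def space_config_space)

lemma sampling_law_image_mset:
  assumes h: "h \<in> measurable \<mu> (count_space J)" and J: "finite J" and m: "set_mset m \<subseteq> J"
  shows "{\<phi> \<in> space (poisson_sampling_law \<mu>). image_mset h \<phi> = m} \<in> sets (poisson_sampling_law \<mu>)"
    and "measure (poisson_sampling_law \<mu>) {\<phi> \<in> space (poisson_sampling_law \<mu>). image_mset h \<phi> = m}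
    = (\<Prod>j\<in>J. exp (- measure \<mu> (h -` {j} \<inter> space \<mu>)) *
         measure \<mu> (h -` {j} \<inter> space \<mu>) ^ count m j / fact (count m j))"
proof -
  have "image_mset h -` {m} \<inter> space (config_space \<mu>) \<in> sets (config_space \<mu>)"
    using m by (intro measurable_sets[OF image_mset_measurable[OF h J]]) auto
  also have "image_mset h -` {m} \<inter> space (config_space \<mu>)
     = {\<phi> \<in> space (poisson_sampling_law \<mu>). image_mset h \<phi> = m}"
    by (auto simp: space_sampling_law space_config_space)
  finally have S: "{\<phi> \<in> space (poisson_sampling_law \<mu>). image_mset h \<phi> = m} \<in> sets (config_space \<mu>)" .
  then show "{\<phi> \<in> space (poisson_sampling_law \<mu>). image_mset h \<phi> = m} \<in> sets (poisson_sampling_law \<mu>)"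
    by (simp add: sets_sampling_law)
  have "measure (poisson_sampling_law \<mu>) {\<phi> \<in> space (poisson_sampling_law \<mu>). image_mset h \<phi> = m}
     = measure (poisson_sampling \<mu>) (sampled_points -` {\<phi> \<in> space (poisson_sampling_law \<mu>). image_mset h \<phi> = m}
          \<inter> space (poisson_sampling \<mu>))"
    using S unfolding poisson_sampling_law_def by (intro measure_distr sampled_points_measurable)
  also have "sampled_points -` {\<phi> \<in> space (poisson_sampling_law \<mu>). image_mset h \<phi> = m} \<inter> space (poisson_sampling \<mu>)
     = {\<omega> \<in> space (poisson_sampling \<mu>). image_mset h (sampled_points \<omega>) = m}"
    using sampled_points_space by (auto simp: space_sampling_law)
  finally show "measure (poisson_sampling_law \<mu>) {\<phi> \<in> space (poisson_sampling_law \<mu>). image_mset h \<phi> = m}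
    = (\<Prod>j\<in>J. exp (- measure \<mu> (h -` {j} \<inter> space \<mu>)) *
         measure \<mu> (h -` {j} \<inter> space \<mu>) ^ count m j / fact (count m j))"
    using measure_sampled_labels[OF h J m] by simp
qed

text \<open>Points outside all the sets \<open>B i\<close> receive the extra label \<open>None\<close>. Summing the joint law of the labels
over the number of such points leaves the product over \<open>I\<close>, since Poisson weights sum to one.\<close>

lemma sampling_law_num_points:
  fixes B :: "'i \<Rightarrow> 'a set"
  assumes I: "finite I" and B: "\<And>i. i \<in> I \<Longrightarrow> B i \<in> sets \<mu>" and disj: "disjoint_family_on B I"
  shows "measure (poisson_sampling_law \<mu>)
      {\<phi> \<in> space (poisson_sampling_law \<mu>). \<forall>i\<in>I. num_points (B i) \<phi> = k i}
    = (\<Prod>i\<in>I. exp (- measure \<mu> (B i)) * measure \<mu> (B i) ^ k i / fact (k i))"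
proof -
  let ?P = "poisson_sampling_law \<mu>"
  interpret P: prob_space ?P by (rule prob_sampling_law)
  define h where "h x = (if \<exists>i\<in>I. x \<in> B i then Some (THE i. i \<in> I \<and> x \<in> B i) else None)" for x
  define J where "J = insert None (Some ` I)"
  have h_Some: "h x = Some i" if "i \<in> I" "x \<in> B i" for x i
  proof -
    have "(THE i. i \<in> I \<and> x \<in> B i) = i"
      using that disj by (intro the_equality) (auto simp: disjoint_family_on_def)
    then show ?thesis using that by (auto simp: h_def)
  qed
  have h_None: "h x = None" if "\<not> (\<exists>i\<in>I. x \<in> B i)" for x
    using that by (simp add: h_def)
  have h_cases: "h x \<in> J" for x
    by (cases "\<exists>i\<in>I. x \<in> B i") (auto simp: h_Some h_None J_def)
  have Some_D: "x \<in> B i" if "h x = Some i" for x i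
    using h_None[of x] h_Some[of _ x] that by fastforce
  have vimage_Some: "h -` {Some i} \<inter> space \<mu> = B i" if "i \<in> I" for i
    using sets.sets_into_space[OF B[OF that]] h_Some[OF that] by (auto dest: Some_D)
  have vimage_None: "h -` {None} \<inter> space \<mu> = space \<mu> - (\<Union>i\<in>I. B i)"
    by (auto simp: h_Some dest: Some_D intro: h_None)
  have J: "finite J" using I by (simp add: J_def)
  have h: "h \<in> measurable \<mu> (count_space J)"
    using h_cases B I vimage_None vimage_Some
    by (subst measurable_count_space_eq2[OF J]) (auto simp: J_def vimage_Some)
  define m where "m j = replicate_mset j None + (\<Sum>i\<in>I. replicate_mset (k i) (Some i))" for j
  have count_Some: "count (m j) (Some i) = k i" if "i \<in> I" for i j
    using I that by (simp add: m_def count_sum)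
  have count_None: "count (m j) None = j" for j
    by (simp add: m_def count_sum)
  have set_m: "set_mset (m j) \<subseteq> J" for j
    using I by (auto simp: m_def J_def set_mset_sum in_replicate_mset split: if_splits)
  have "(\<lambda>j. measure ?P {\<phi> \<in> space ?P. image_mset h \<phi> = m j})
     sums measure ?P (\<Union>j. {\<phi> \<in> space ?P. image_mset h \<phi> = m j})"
  proof (rule P.finite_measure_UNION)
    show "range (\<lambda>j. {\<phi> \<in> space ?P. image_mset h \<phi> = m j}) \<subseteq> P.events"
      using sampling_law_image_mset(1)[OF h J set_m] by auto
    show "disjoint_family (\<lambda>j. {\<phi> \<in> space ?P. image_mset h \<phi> = m j})"
      by (auto simp: disjoint_family_on_def) (metis count_None)
  qed
  moreover have "(\<Union>j. {\<phi> \<in> space ?P. image_mset h \<phi> = m j})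
     = {\<phi> \<in> space ?P. \<forall>i\<in>I. num_points (B i) \<phi> = k i}" (is "?L = ?R")
  proof (intro set_eqI iffI)
    fix \<phi> assume "\<phi> \<in> ?L"
    then obtain j where \<phi>: "\<phi> \<in> space ?P" "image_mset h \<phi> = m j" by blast
    then have s: "set_mset \<phi> \<subseteq> space \<mu>" by (simp add: space_sampling_law)
    have "num_points (B i) \<phi> = k i" if "i \<in> I" for i
      using count_image_mset_num_points[OF s, of h "Some i"] \<phi>(2) that
      by (simp add: vimage_Some count_Some)
    then show "\<phi> \<in> ?R" using \<phi> by simp
  next
    fix \<phi> assume \<phi>: "\<phi> \<in> ?R"
    then have s: "set_mset \<phi> \<subseteq> space \<mu>" by (simp add: space_sampling_law)
    let ?j = "count (image_mset h \<phi>) None"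
    have "count (image_mset h \<phi>) l = count (m ?j) l" for l
    proof (cases "l \<in> J")
      case False
      have "set_mset (image_mset h \<phi>) \<subseteq> J" using h_cases by auto
      with False set_m[of ?j] show ?thesis by (metis count_inI subsetD)
    next
      case True
      then consider "l = None" | i where "l = Some i" "i \<in> I" by (auto simp: J_def)
      then show ?thesis
      proof cases
        case 1 then show ?thesis by (simp only: count_None)
      next
        case 2
        then show ?thesis using \<phi> count_image_mset_num_points[OF s, of h "Some i"]
          by (simp add: vimage_Some count_Some)
      qed
    qed
    then have "image_mset h \<phi> = m ?j" by (rule multiset_eqI)
    then show "\<phi> \<in> ?L" using \<phi> by blast
  qed
  moreover have "measure ?P {\<phi> \<in> space ?P. image_mset h \<phi> = m j}
     = exp (- measure \<mu> (h -` {None} \<inter> space \<mu>)) * measure \<mu> (h -` {None} \<inter> space \<mu>) ^ j / fact j *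
       (\<Prod>i\<in>I. exp (- measure \<mu> (B i)) * measure \<mu> (B i) ^ k i / fact (k i))" for j
    unfolding sampling_law_image_mset(2)[OF h J set_m] unfolding J_def
    using I by (subst prod.insert)
      (auto simp: prod.reindex count_None count_Some vimage_Some intro!: prod.cong)
  ultimately have "(\<lambda>j. exp (- measure \<mu> (h -` {None} \<inter> space \<mu>)) * measure \<mu> (h -` {None} \<inter> space \<mu>) ^ j / fact j *
       (\<Prod>i\<in>I. exp (- measure \<mu> (B i)) * measure \<mu> (B i) ^ k i / fact (k i)))
     sums measure ?P {\<phi> \<in> space ?P. \<forall>i\<in>I. num_points (B i) \<phi> = k i}" by simp
  from sums_unique2[OF this sums_mult2[OF poisson_weights_sums]] show ?thesis by simp
qed

text \<open>The product formula for finitely many disjoint sets gives the independence of the events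
\<open>num_points (B i) \<phi> = k\<close>. Together with the empty set they are closed under intersection, so independence
extends to the sigma-algebras that they generate.\<close>

lemma poisson_point_process_sampling_law:
  "poisson_point_process (poisson_sampling_law \<mu>) \<mu> (\<lambda>\<phi>. \<phi>)"
  unfolding poisson_point_process_def
proof (intro conjI allI impI ballI)
  let ?P = "poisson_sampling_law \<mu>"
  interpret P: prob_space ?P by (rule prob_sampling_law)
  show "prob_space ?P" by unfold_locales
  show "finite_measure \<mu>" by unfold_locales
  show "(\<lambda>\<phi>. \<phi>) \<in> measurable ?P (config_space \<mu>)"
    using sets_sampling_law by (intro measurable_ident_sets)
  have single: "measure ?P {\<omega> \<in> space ?P. num_points B \<omega> = k}
      = exp (- measure \<mu> B) * measure \<mu> B ^ k / fact k" if "B \<in> sets \<mu>" for B k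
    using sampling_law_num_points[of "{()}" "\<lambda>_. B" "\<lambda>_. k"] that
    by (simp add: disjoint_family_on_def)
  then show "measure ?P {\<omega> \<in> space ?P. num_points B \<omega> = k}
      = exp (- measure \<mu> B) * measure \<mu> B ^ k / fact k" if "B \<in> sets \<mu>" for B k
    using that .
  fix n and B :: "nat \<Rightarrow> 'a set"
  assume B: "(\<forall>i<n. B i \<in> sets \<mu>) \<and> disjoint_family_on B {..<n}"
  have N: "num_points (B i) \<in> measurable ?P (count_space UNIV)" if "i < n" for i
    using num_points_measurable[of "B i" \<mu>] B that measurable_cong_sets[OF sets_sampling_law refl] by blast
  define F where "F i = insert {} (range (\<lambda>k. {\<phi> \<in> space ?P. num_points (B i) \<phi> = k}))" for i
  have ind: "P.indep_sets F {..<n}"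
  proof (rule P.indep_setsI)
    show "F i \<subseteq> P.events" if "i \<in> {..<n}" for i
    proof -
      have "{\<phi> \<in> space ?P. num_points (B i) \<phi> = k} \<in> P.events" for k
        using measurable_sets[OF N, of i "{k}"] that by (simp add: vimage_def Collect_conj_eq Int_commute)
      then show ?thesis by (auto simp: F_def)
    qed
    fix A J assume J: "J \<noteq> {}" "J \<subseteq> {..<n}" "finite J" and A: "\<forall>j\<in>J. A j \<in> F j"
    show "P.prob (\<Inter>j\<in>J. A j) = (\<Prod>j\<in>J. P.prob (A j))"
    proof (cases "\<exists>j\<in>J. A j = {}")
      case True
      then obtain j where j: "j \<in> J" "A j = {}" by blast
      then have "(\<Inter>j\<in>J. A j) = {}" by blast
      moreover have "(\<Prod>j\<in>J. P.prob (A j)) = 0"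
        using j J(3) by (intro prod_zero bexI[of _ j]) auto
      ultimately show ?thesis by simp
    next
      case False
      have "\<forall>j\<in>J. \<exists>k. A j = {\<phi> \<in> space ?P. num_points (B j) \<phi> = k}"
        using A False by (force simp: F_def)
      then obtain k where k: "\<And>j. j \<in> J \<Longrightarrow> A j = {\<phi> \<in> space ?P. num_points (B j) \<phi> = k j}" by metis
      have "(\<Inter>j\<in>J. A j) = {\<phi> \<in> space ?P. \<forall>j\<in>J. num_points (B j) \<phi> = k j}"
        using k J(1) by auto
      moreover have "disjoint_family_on B J" using B J by (meson disjoint_family_on_mono)
      ultimately have "P.prob (\<Inter>j\<in>J. A j) = (\<Prod>i\<in>J. exp (- measure \<mu> (B i)) * measure \<mu> (B i) ^ k i / fact (k i))"
        using sampling_law_num_points[of J B k] B J by (simp add: subset_iff)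
      also have "\<dots> = (\<Prod>j\<in>J. P.prob (A j))"
        using k single B J by (intro prod.cong refl) (auto simp: subset_iff)
      finally show ?thesis .
    qed
  qed
  have "Int_stable (F i)" for i unfolding Int_stable_def F_def by auto
  with ind have ind: "P.indep_sets (\<lambda>i. sigma_sets (space ?P) (F i)) {..<n}"
    by (intro P.indep_sets_sigma) auto
  show "P.indep_vars (\<lambda>_. count_space UNIV) (\<lambda>i \<phi>. num_points (B i) \<phi>) {..<n}"
    unfolding P.indep_vars_def2
  proof (intro conjI ballI)
    show "P.random_variable (count_space UNIV) (num_points (B i))" if "i \<in> {..<n}" for i
      using N that by simp
    show "P.indep_sets (\<lambda>i. {(\<lambda>\<phi>. num_points (B i) \<phi>) -` A \<inter> space ?P | A. A \<in> sets (count_space UNIV)}) {..<n}"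
    proof (rule P.indep_sets_mono_sets[OF ind], safe)
      fix i A
      have "(\<lambda>\<phi>. num_points (B i) \<phi>) -` A \<inter> space ?P = (\<Union>k\<in>A. {\<phi> \<in> space ?P. num_points (B i) \<phi> = k})"
        by auto
      moreover have "(\<Union>k\<in>A. {\<phi> \<in> space ?P. num_points (B i) \<phi> = k}) \<in> sigma_sets (space ?P) (F i)"
        by (intro sigma_sets_UNION countable_image) (auto simp: F_def intro!: sigma_sets.Basic)
      ultimately show "(\<lambda>\<phi>. num_points (B i) \<phi>) -` A \<inter> space ?P \<in> sigma_sets (space ?P) (F i)" by simp
    qed
  qed
qed

lemma poisson_law_eq_sampling_law: "poisson_law \<mu> = poisson_sampling_law \<mu>"
  unfolding poisson_law_def
  by (intro the_equality conjI sets_sampling_law poisson_point_process_sampling_law)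
    (use poisson_law_unique sets_sampling_law poisson_point_process_sampling_law in blast)

end

section \<open>Discretization and multiple points\<close>

lemma AE_pair_fst:
  assumes "prob_space N" "AE x in M. Q x"
  shows "AE p in M \<Otimes>\<^sub>M N. Q (fst p)"
proof -
  interpret N: prob_space N by fact
  have "AE x in distr (M \<Otimes>\<^sub>M N) M fst. Q x" by (subst N.distr_pair_fst) (rule assms(2))
  then show ?thesis by (rule AE_distrD[OF measurable_fst])
qed

lemma AE_pair_snd:
  assumes "prob_space M" "sigma_finite_measure N" "AE x in N. Q x"
  shows "AE p in M \<Otimes>\<^sub>M N. Q (snd p)"
proof -
  interpret M: prob_space M by fact
  interpret N: sigma_finite_measure N by fact
  from assms(3) obtain Z where Z: "{x \<in> space N. \<not> Q x} \<subseteq> Z" "emeasure N Z = 0" "Z \<in> sets N"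
    by (rule AE_E)
  have "emeasure (M \<Otimes>\<^sub>M N) (space M \<times> Z) = 0"
    using Z by (simp add: N.emeasure_pair_measure_Times)
  then show ?thesis
    using Z by (intro AE_I[of _ _ "space M \<times> Z"]) (auto simp: space_pair_measure)
qed

lemma eventually_inj_on_approximation:
  fixes F :: "nat \<Rightarrow> 'a \<Rightarrow> 'a::metric_space"
  assumes A: "finite A" and F: "\<And>x. x \<in> A \<Longrightarrow> (\<lambda>k. F k x) \<longlonglongrightarrow> x"
  shows "eventually (\<lambda>k. inj_on (F k) A) sequentially"
proof -
  have "eventually (\<lambda>k. x \<noteq> y \<longrightarrow> F k x \<noteq> F k y) sequentially" if "x \<in> A" "y \<in> A" for x y
  proof (cases "x = y")
    case False
    have "(\<lambda>k. dist (F k x) (F k y)) \<longlonglongrightarrow> dist x y" using that F by (intro tendsto_dist)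
    then have "eventually (\<lambda>k. 0 < dist (F k x) (F k y)) sequentially"
      using False by (intro order_tendstoD) auto
    then show ?thesis by eventually_elim auto
  qed simp
  then have "eventually (\<lambda>k. \<forall>x\<in>A. \<forall>y\<in>A. x \<noteq> y \<longrightarrow> F k x \<noteq> F k y) sequentially"
    using A by (intro eventually_ball_finite ballI) auto
  then show ?thesis by eventually_elim (auto simp: inj_on_def)
qed

lemma count_image_mset_le: "count \<phi> x \<le> count (image_mset h \<phi>) (h x)"
  by (induction \<phi>) auto

lemma count_image_mset_inj_on:
  assumes "inj_on h (set_mset \<phi>)" "x \<in># \<phi>"
  shows "count (image_mset h \<phi>) (h x) = count \<phi> x"
proof -
  have "h -` {h x} \<inter> set_mset \<phi> = {x}" using assms by (auto simp: inj_on_def)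
  then show ?thesis by (simp add: count_image_mset)
qed

definition simple_configuration :: "'a multiset \<Rightarrow> bool" where
  "simple_configuration \<phi> \<longleftrightarrow> (\<forall>x. count \<phi> x \<le> 1)"

lemma simple_configuration_image_mset:
  assumes "simple_configuration (image_mset h \<phi>)" shows "simple_configuration \<phi>"
  using assms count_image_mset_le[of \<phi> _ h] unfolding simple_configuration_def by (meson order_trans)

lemma simple_configuration_image_mset_inj_on:
  assumes \<phi>: "simple_configuration \<phi>" and h: "inj_on h (set_mset \<phi>)"
  shows "simple_configuration (image_mset h \<phi>)"
  unfolding simple_configuration_def
proof
  fix y show "count (image_mset h \<phi>) y \<le> 1"
  proof (cases "y \<in># image_mset h \<phi>")
    case True
    then obtain x where "x \<in># \<phi>" "y = h x" by auto
    then show ?thesis using count_image_mset_inj_on[OF h, of x] \<phi> by (simp add: simple_configuration_def)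
  next
    case False
    then have "count (image_mset h \<phi>) y = 0" by (simp only: not_in_iff)
    then show ?thesis by simp
  qed
qed

lemma sum_mset_simple_configuration:
  assumes "simple_configuration \<phi>"
  shows "(\<Sum>x\<in>#\<phi>. f x) = (\<Sum>x\<in>set_mset \<phi>. f x)"
proof -
  have "\<phi> = mset_set (set_mset \<phi>)"
  proof (rule multiset_eqI)
    fix x have "count \<phi> x \<le> 1" using assms by (simp add: simple_configuration_def)
    then have "count \<phi> x = 1" if "x \<in># \<phi>"
      using that by (simp only: count_greater_zero_iff[symmetric])
    then show "count \<phi> x = count (mset_set (set_mset \<phi>)) x"
      by (cases "x \<in># \<phi>") (auto simp: not_in_iff)
  qed
  then show ?thesis by (metis sum_unfold_sum_mset)
qed

lemma measurable_simple_function_image: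
  assumes "simple_function \<mu> h"
  shows "h \<in> measurable \<mu> (count_space (h ` space \<mu>))"
  using assms unfolding simple_function_def by (subst measurable_count_space_eq2) auto

text \<open>Replacing each point by a nearby one from a finite set turns statements about arbitrary configurations
into limits of statements about discretizations, which take countably many values. This is how the
measurability statements below are proved.\<close>

lemma identity_approximation:
  fixes \<mu> :: "'a::{metric_space, second_countable_topology} measure"
  assumes "(\<lambda>x. x) \<in> borel_measurable \<mu>"
  obtains F :: "nat \<Rightarrow> 'a \<Rightarrow> 'a" where
    "\<And>k. finite (F k ` space \<mu>)"
    "\<And>k. F k \<in> measurable \<mu> (count_space (F k ` space \<mu>))"
    "\<And>x. x \<in> space \<mu> \<Longrightarrow> (\<lambda>k. F k x) \<longlonglongrightarrow> x"
proof -
  from borel_measurable_implies_sequence_metric[OF assms, of undefined]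
  obtain F where F: "\<And>k. simple_function \<mu> (F k)" "\<And>x. x \<in> space \<mu> \<Longrightarrow> (\<lambda>k. F k x) \<longlonglongrightarrow> x" by blast
  show ?thesis
    using F by (intro that[of F]) (auto intro: measurable_simple_function_image simp: simple_function_def)
qed

text \<open>A discretization can only merge points. It therefore never makes a multiple point simple, and a fine
enough one keeps the finitely many points of a given configuration apart.\<close>

lemma simple_configuration_measurable:
  fixes \<mu> :: "'a::{metric_space, second_countable_topology} measure"
  assumes "(\<lambda>x. x) \<in> borel_measurable \<mu>"
  shows "{\<phi> \<in> space (config_space \<mu>). simple_configuration \<phi>} \<in> sets (config_space \<mu>)"
proof -
  obtain F :: "nat \<Rightarrow> 'a \<Rightarrow> 'a" where F: "\<And>k. finite (F k ` space \<mu>)"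
    "\<And>k. F k \<in> measurable \<mu> (count_space (F k ` space \<mu>))"
    "\<And>x. x \<in> space \<mu> \<Longrightarrow> (\<lambda>k. F k x) \<longlonglongrightarrow> x"
    by (rule identity_approximation[OF assms]) blast
  let ?C = "\<lambda>k. {m. set_mset m \<subseteq> F k ` space \<mu>}"
  have "{\<phi> \<in> space (config_space \<mu>). simple_configuration \<phi>}
    = (\<Union>k. image_mset (F k) -` {m \<in> ?C k. simple_configuration m} \<inter> space (config_space \<mu>))" (is "?L = ?R")
  proof (intro set_eqI iffI)
    fix \<phi> assume \<phi>: "\<phi> \<in> ?L"
    then have "eventually (\<lambda>k. inj_on (F k) (set_mset \<phi>)) sequentially"
      using F(3) by (intro eventually_inj_on_approximation) (auto simp: space_config_space)
    then obtain k where "inj_on (F k) (set_mset \<phi>)" by (auto simp: eventually_sequentially)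
    then have "simple_configuration (image_mset (F k) \<phi>)"
      using \<phi> by (intro simple_configuration_image_mset_inj_on) auto
    then show "\<phi> \<in> ?R" using \<phi> by (auto simp: space_config_space)
  next
    fix \<phi> assume "\<phi> \<in> ?R"
    then show "\<phi> \<in> ?L" using simple_configuration_image_mset by blast
  qed
  also have "\<dots> \<in> sets (config_space \<mu>)"
    by (intro sets.countable_UN subsetI, safe, rule measurable_sets[OF image_mset_measurable[OF F(2,1)]]) auto
  finally show ?thesis .
qed

context nonzero_finite_measure
begin

lemma distr_samples_pair:
  assumes "i \<noteq> j"
  shows "\<nu> \<Otimes>\<^sub>M \<nu> = distr samples (\<nu> \<Otimes>\<^sub>M \<nu>) (\<lambda>X. (X i, X j))"
proof (rule pair_measure_eqI)
  show "sigma_finite_measure \<nu>" "sigma_finite_measure \<nu>" by unfold_locales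
  fix A B assume AB: "A \<in> sets \<nu>" "B \<in> sets \<nu>"
  have "emeasure (distr samples (\<nu> \<Otimes>\<^sub>M \<nu>) (\<lambda>X. (X i, X j))) (A \<times> B)
     = emeasure samples {X \<in> space samples. \<forall>l\<in>{i, j}. X l \<in> (if l = i then A else B)}"
    using AB assms by (subst emeasure_distr) (auto intro!: arg_cong[of _ _ "emeasure samples"])
  also have "\<dots> = (\<Prod>l\<in>{i, j}. emeasure \<nu> (if l = i then A else B))"
    using AB by (intro samples.emeasure_PiM_Collect) auto
  finally show "emeasure \<nu> A * emeasure \<nu> B = emeasure (distr samples (\<nu> \<Otimes>\<^sub>M \<nu>) (\<lambda>X. (X i, X j))) (A \<times> B)"
    using assms by simp
qed simp

end

text \<open>Without atoms, two independent points almost surely differ, so the process has no multiple points.\<close>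

locale diffuse_finite_measure = nonzero_finite_measure \<mu>
  for \<mu> :: "'a::{metric_space, second_countable_topology} measure" +
  assumes id_measurable [measurable]: "(\<lambda>x. x) \<in> borel_measurable \<mu>"
    and null_singleton: "x \<in> space \<mu> \<Longrightarrow> emeasure \<mu> {x} = 0"
begin

lemma AE_samples_distinct:
  assumes "i \<noteq> j"
  shows "AE X in samples. X i \<noteq> X j"
proof -
  have [measurable]: "(\<lambda>x. x) \<in> borel_measurable \<nu>"
    by (simp add: measurable_cong_sets[OF sets_uniform_measure refl] id_measurable)
  let ?D = "{p \<in> space (\<nu> \<Otimes>\<^sub>M \<nu>). dist (fst p) (snd p) = 0}"
  have [measurable]: "fst \<in> borel_measurable (\<nu> \<Otimes>\<^sub>M \<nu>)" "snd \<in> borel_measurable (\<nu> \<Otimes>\<^sub>M \<nu>)"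
    by (rule measurable_compose[OF measurable_fst]; simp) (rule measurable_compose[OF measurable_snd]; simp)
  have D: "?D \<in> sets (\<nu> \<Otimes>\<^sub>M \<nu>)" by measurable
  have "emeasure (\<nu> \<Otimes>\<^sub>M \<nu>) ?D = (\<integral>\<^sup>+x. emeasure \<nu> (Pair x -` ?D) \<partial>\<nu>)"
    using D by (intro samples.M.emeasure_pair_measure_alt)
  also have "\<dots> = (\<integral>\<^sup>+x. 0 \<partial>\<nu>)"
  proof (intro nn_integral_cong)
    fix x assume x: "x \<in> space \<nu>"
    have S: "{x} = {y \<in> space \<mu>. dist x y = 0}" using x by auto
    have "{x} \<in> sets \<mu>" by (subst S) measurable
    moreover have "Pair x -` ?D = {x}" using x by (auto simp: space_pair_measure)
    ultimately show "emeasure \<nu> (Pair x -` ?D) = 0"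
      using null_singleton[of x] x by (simp add: Int_absorb1)
  qed
  finally have "emeasure (\<nu> \<Otimes>\<^sub>M \<nu>) ?D = 0" by simp
  then have "AE p in \<nu> \<Otimes>\<^sub>M \<nu>. fst p \<noteq> snd p"
    using D by (intro AE_I[of _ _ ?D]) auto
  then have "AE p in distr samples (\<nu> \<Otimes>\<^sub>M \<nu>) (\<lambda>X. (X i, X j)). fst p \<noteq> snd p"
    by (subst distr_samples_pair[OF assms, symmetric])
  from AE_distrD[OF _ this] show ?thesis by simp
qed

lemma AE_simple_configuration: "AE \<phi> in poisson_law \<mu>. simple_configuration \<phi>"
proof -
  have "AE X in samples. \<forall>i j. i \<noteq> j \<longrightarrow> X i \<noteq> X j"
    unfolding AE_all_countable using AE_samples_distinct by auto
  then have "AE \<omega> in poisson_sampling \<mu>. \<forall>i j. i \<noteq> j \<longrightarrow> snd \<omega> i \<noteq> snd \<omega> j"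
    unfolding poisson_sampling_def
    by (intro AE_pair_snd[where Q="\<lambda>X. \<forall>i j. i \<noteq> j \<longrightarrow> X i \<noteq> X j"])
      (auto intro: samples.P.sigma_finite_measure_axioms measure_pmf.prob_space_axioms)
  then have "AE \<omega> in poisson_sampling \<mu>. simple_configuration (sampled_points \<omega>)"
  proof eventually_elim
    case (elim \<omega>)
    then have "distinct (map (snd \<omega>) [0..<fst \<omega>])" by (simp add: distinct_map inj_on_def) metis
    then show ?case unfolding simple_configuration_def sampled_points_def
      by (metis distinct_count_atmost_1 le_numeral_extra(4) zero_le)
  qed
  then show ?thesis unfolding poisson_law_eq_sampling_law poisson_sampling_law_def
    using simple_configuration_measurable[OF id_measurable] sampled_points_measurable
    by (subst AE_distr_iff) auto
qed

end

section \<open>Shares of a configuration\<close>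

text \<open>The integrand in the expected share, for the configurations \<open>\<phi>\<close> of the player and \<open>\<psi>\<close> of the opponent.\<close>

definition configuration_share :: "'a::metric_space measure \<Rightarrow> 'a multiset \<Rightarrow> 'a multiset \<Rightarrow> real" where
  "configuration_share \<eta> \<phi> \<psi> = (\<Sum>x\<in>#\<phi>. measure \<eta> (voronoi_cell (space \<eta>) (\<phi> + \<psi>) x))"

lemma tendsto_sum_mset:
  fixes l :: "'a \<Rightarrow> 'b::topological_comm_monoid_add"
  assumes "\<And>x. x \<in># \<phi> \<Longrightarrow> ((\<lambda>k. f k x) \<longlongrightarrow> l x) F"
  shows "((\<lambda>k. \<Sum>x\<in>#\<phi>. f k x) \<longlongrightarrow> (\<Sum>x\<in>#\<phi>. l x)) F"
  using assms by (induction \<phi>) (auto intro!: tendsto_add)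

lemma sum_set_mset_le_sum_mset:
  fixes f :: "'a \<Rightarrow> real"
  assumes "\<And>x. 0 \<le> f x"
  shows "(\<Sum>x\<in>set_mset \<phi>. f x) \<le> (\<Sum>x\<in>#\<phi>. f x)"
proof (induction \<phi>)
  case (add x \<phi>)
  then show ?case using assms[of x] by (cases "x \<in># \<phi>") (auto simp: insert_absorb)
qed simp

lemma configuration_share_nonneg: "0 \<le> configuration_share \<eta> \<phi> \<psi>"
  unfolding configuration_share_def by (rule order_trans[OF _ sum_set_mset_le_sum_mset]) (auto intro: sum_nonneg)

text \<open>Null bisectors make ties between distinct points negligible: the open Voronoi cells of a nonempty
configuration then cover almost all of the space, and the mass of a cell depends continuously on the points.\<close>

locale hotelling_space = finite_measure \<eta>
  for \<eta> :: "'a::{metric_space, second_countable_topology} measure" +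
  assumes id_measurable [measurable]: "(\<lambda>x. x) \<in> borel_measurable \<eta>"
    and null_singleton: "x \<in> space \<eta> \<Longrightarrow> emeasure \<eta> {x} = 0"
    and null_bisector: "\<lbrakk>x \<in> space \<eta>; y \<in> space \<eta>; x \<noteq> y\<rbrakk> \<Longrightarrow> emeasure \<eta> {z \<in> space \<eta>. dist x z = dist y z} = 0"
begin

abbreviation "cell \<equiv> voronoi_cell (space \<eta>)"
abbreviation "share \<equiv> configuration_share \<eta>"

lemma sets_cell [measurable]: "cell \<xi> x \<in> sets \<eta>"
  unfolding voronoi_cell_def by measurable

lemma sets_bisector [measurable]: "{z \<in> space \<eta>. dist x z = dist y z} \<in> sets \<eta>"
  by measurable

lemma AE_no_ties:
  assumes "set_mset \<xi> \<subseteq> space \<eta>"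
  shows "AE z in \<eta>. \<forall>x\<in>set_mset \<xi>. \<forall>y\<in>set_mset \<xi>. x \<noteq> y \<longrightarrow> dist x z \<noteq> dist y z"
proof (intro AE_finite_allI finite_set_mset)
  fix x y assume xy: "x \<in># \<xi>" "y \<in># \<xi>"
  show "AE z in \<eta>. x \<noteq> y \<longrightarrow> dist x z \<noteq> dist y z"
  proof (cases "x = y")
    case False
    then have "emeasure \<eta> {z \<in> space \<eta>. dist x z = dist y z} = 0"
      using xy assms by (intro null_bisector) auto
    then show ?thesis by (intro AE_I[OF _ _ sets_bisector]) auto
  qed simp
qed

text \<open>Away from the bisectors of the points of \<open>\<xi>\<close>, membership in a cell is decided by strict inequalities
between distances. These are stable under small perturbations of the points, so dominated convergence
applies. Injectivity of the perturbation matters because equal points do not compete with each other.\<close>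

lemma tendsto_measure_cell:
  assumes \<xi>: "set_mset \<xi> \<subseteq> space \<eta>" and x: "x \<in># \<xi>"
    and F: "\<And>y. y \<in> space \<eta> \<Longrightarrow> (\<lambda>k. F k y) \<longlonglongrightarrow> y"
  shows "(\<lambda>k. measure \<eta> (cell (image_mset (F k) \<xi>) (F k x))) \<longlonglongrightarrow> measure \<eta> (cell \<xi> x)"
proof -
  have "(\<lambda>k. \<integral>z. indicator (cell (image_mset (F k) \<xi>) (F k x)) z \<partial>\<eta>) \<longlonglongrightarrow> (\<integral>z. (indicator (cell \<xi> x) z :: real) \<partial>\<eta>)"
  proof (rule integral_dominated_convergence[where w="\<lambda>_. 1"])
    show "AE z in \<eta>. (\<lambda>k. indicator (cell (image_mset (F k) \<xi>) (F k x)) z :: real) \<longlonglongrightarrow> indicator (cell \<xi> x) z"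
      using AE_no_ties[OF \<xi>] AE_space
    proof eventually_elim
      case (elim z)
      have "eventually (\<lambda>k. dist (F k x) z < dist (F k y) z \<longleftrightarrow> dist x z < dist y z) sequentially"
        if y: "y \<in># \<xi>" "y \<noteq> x" for y
      proof -
        have lim: "(\<lambda>k. dist (F k x) z) \<longlonglongrightarrow> dist x z" "(\<lambda>k. dist (F k y) z) \<longlonglongrightarrow> dist y z"
          using F x y \<xi> by (auto intro!: tendsto_dist)
        have "dist x z \<noteq> dist y z" using elim(1)[rule_format, OF x y(1)] y(2) by auto
        then consider "dist x z < dist y z" | "dist y z < dist x z" by linarith
        then show ?thesis
        proof cases
          case 1
          from 1 have "dist x z < (dist x z + dist y z) / 2" "(dist x z + dist y z) / 2 < dist y z" by auto
          from order_tendstoD(2)[OF lim(1) this(1)] order_tendstoD(1)[OF lim(2) this(2)]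
          show ?thesis
          proof eventually_elim
            case (elim k)
            with 1 show ?case by linarith
          qed
        next
          case 2
          from 2 have "dist y z < (dist x z + dist y z) / 2" "(dist x z + dist y z) / 2 < dist x z" by auto
          from order_tendstoD(2)[OF lim(2) this(1)] order_tendstoD(1)[OF lim(1) this(2)]
          show ?thesis
          proof eventually_elim
            case (elim k)
            with 2 show ?case by linarith
          qed
        qed
      qed
      then have "eventually (\<lambda>k. y \<noteq> x \<longrightarrow>
          (dist (F k x) z < dist (F k y) z \<longleftrightarrow> dist x z < dist y z)) sequentially" if "y \<in># \<xi>" for y
        using that by (cases "y = x") simp_all
      then have "eventually (\<lambda>k. \<forall>y\<in>set_mset \<xi>. y \<noteq> x \<longrightarrow>
          (dist (F k x) z < dist (F k y) z \<longleftrightarrow> dist x z < dist y z)) sequentially"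
        by (intro eventually_ball_finite ballI finite_set_mset)
      moreover have "eventually (\<lambda>k. inj_on (F k) (set_mset \<xi>)) sequentially"
        using F \<xi> by (intro eventually_inj_on_approximation) auto
      ultimately have "eventually (\<lambda>k. indicator (cell (image_mset (F k) \<xi>) (F k x)) z
          = (indicator (cell \<xi> x) z :: real)) sequentially"
      proof eventually_elim
        case (elim k)
        have "F k y = F k x \<longleftrightarrow> y = x" if "y \<in># \<xi>" for y
          using elim(2) that x by (auto simp: inj_on_def)
        then have "z \<in> cell (image_mset (F k) \<xi>) (F k x) \<longleftrightarrow> z \<in> cell \<xi> x"
          using elim(1) unfolding voronoi_cell_def by auto
        then show ?case by (simp add: indicator_def)
      qed
      then show ?case by (rule tendsto_eventually)
    qed
  qed (auto simp: indicator_def)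
  then show ?thesis by simp
qed

text \<open>The share is the pointwise limit of the shares of discretized configurations; each of these is a
function of a pair of discretizations, which range over a countable set.\<close>

lemma share_measurable:
  "(\<lambda>\<omega>. share (fst \<omega>) (snd \<omega>)) \<in> borel_measurable (config_space \<eta> \<Otimes>\<^sub>M config_space \<eta>)"
proof -
  obtain F :: "nat \<Rightarrow> 'a \<Rightarrow> 'a" where F: "\<And>k. finite (F k ` space \<eta>)"
    "\<And>k. F k \<in> measurable \<eta> (count_space (F k ` space \<eta>))"
    "\<And>x. x \<in> space \<eta> \<Longrightarrow> (\<lambda>k. F k x) \<longlonglongrightarrow> x"
    by (rule identity_approximation[OF id_measurable]) blast
  show ?thesis
  proof (rule borel_measurable_LIMSEQ_real)
    fix \<omega> assume "\<omega> \<in> space (config_space \<eta> \<Otimes>\<^sub>M config_space \<eta>)"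
    then have \<omega>: "set_mset (fst \<omega> + snd \<omega>) \<subseteq> space \<eta>"
      by (auto simp: space_pair_measure space_config_space)
    have "(\<lambda>k. \<Sum>x\<in>#fst \<omega>. measure \<eta> (cell (image_mset (F k) (fst \<omega> + snd \<omega>)) (F k x)))
       \<longlonglongrightarrow> (\<Sum>x\<in>#fst \<omega>. measure \<eta> (cell (fst \<omega> + snd \<omega>) x))"
      using \<omega> F(3) by (intro tendsto_sum_mset tendsto_measure_cell) auto
    then show "(\<lambda>k. share (image_mset (F k) (fst \<omega>)) (image_mset (F k) (snd \<omega>))) \<longlonglongrightarrow> share (fst \<omega>) (snd \<omega>)"
      unfolding configuration_share_def by (simp add: multiset.map_comp o_def)
  next
    fix k
    let ?C = "{m. set_mset m \<subseteq> F k ` space \<eta>}"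
    have C: "countable ?C" using F(1) by (intro countable_msets_over countable_finite)
    have I: "image_mset (F k) \<in> measurable (config_space \<eta>) (count_space ?C)"
      by (rule image_mset_measurable[OF F(2,1)])
    have "(\<lambda>\<omega>. (image_mset (F k) (fst \<omega>), image_mset (F k) (snd \<omega>)))
       \<in> measurable (config_space \<eta> \<Otimes>\<^sub>M config_space \<eta>) (count_space (?C \<times> ?C))"
      unfolding pair_measure_countable[OF C C, symmetric]
      by (intro measurable_Pair measurable_compose[OF measurable_fst I] measurable_compose[OF measurable_snd I])
    from measurable_compose[OF this, of "\<lambda>p. share (fst p) (snd p)" borel]
    show "(\<lambda>\<omega>. share (image_mset (F k) (fst \<omega>)) (image_mset (F k) (snd \<omega>)))
       \<in> borel_measurable (config_space \<eta> \<Otimes>\<^sub>M config_space \<eta>)" by simp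
  qed
qed

lemma disjoint_cells: "x \<in># \<xi> \<Longrightarrow> y \<in># \<xi> \<Longrightarrow> x \<noteq> y \<Longrightarrow> cell \<xi> x \<inter> cell \<xi> y = {}"
  unfolding voronoi_cell_def by fastforce

lemma sum_measure_cells_le:
  assumes "A \<subseteq> set_mset \<xi>"
  shows "(\<Sum>x\<in>A. measure \<eta> (cell \<xi> x)) \<le> measure \<eta> (space \<eta>)"
proof -
  have "finite A" using assms by (rule finite_subset) simp
  then have "(\<Sum>x\<in>A. measure \<eta> (cell \<xi> x)) = measure \<eta> (\<Union>x\<in>A. cell \<xi> x)"
  proof (intro finite_measure_finite_Union[symmetric])
    show "disjoint_family_on (cell \<xi>) A"
      unfolding disjoint_family_on_def using assms disjoint_cells by (meson subsetD)
  qed auto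
  also have "\<dots> \<le> measure \<eta> (space \<eta>)" by (rule bounded_measure)
  finally show ?thesis .
qed

lemma share_le:
  assumes "simple_configuration \<phi>" shows "share \<phi> \<psi> \<le> measure \<eta> (space \<eta>)"
  unfolding configuration_share_def sum_mset_simple_configuration[OF assms]
  by (intro sum_measure_cells_le) simp

lemma share_add_le:
  assumes "simple_configuration \<phi>" "simple_configuration \<psi>" "set_mset \<phi> \<inter> set_mset \<psi> = {}"
  shows "share \<phi> \<psi> + share \<psi> \<phi> \<le> measure \<eta> (space \<eta>)"
proof -
  have "share \<phi> \<psi> + share \<psi> \<phi> = (\<Sum>x\<in>set_mset \<phi> \<union> set_mset \<psi>. measure \<eta> (cell (\<phi> + \<psi>) x))"
    unfolding configuration_share_def assms(1,2)[THEN sum_mset_simple_configuration]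
    using assms(3) by (subst sum.union_disjoint) (auto simp: add.commute)
  also have "\<dots> \<le> measure \<eta> (space \<eta>)" by (intro sum_measure_cells_le) auto
  finally show ?thesis .
qed

text \<open>If every point of \<open>Z\<close> has some point of \<open>\<phi>\<close> nearer than any given point of \<open>\<psi>\<close>, then a nearest point
of the joint configuration belongs to \<open>\<phi>\<close>, so that almost all of \<open>Z\<close> lies in cells of \<open>\<phi>\<close>.
Multiple points only increase the share, since their cells are counted repeatedly.\<close>

lemma share_ge:
  assumes \<phi>: "set_mset \<phi> \<subseteq> space \<eta>" "\<phi> \<noteq> {#}" and \<psi>: "set_mset \<psi> \<subseteq> space \<eta>"
    and Z: "Z \<in> sets \<eta>"
    and closer: "\<And>z y. z \<in> Z \<Longrightarrow> y \<in># \<psi> \<Longrightarrow> \<exists>x\<in>#\<phi>. dist x z < dist y z"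
  shows "measure \<eta> Z \<le> share \<phi> \<psi>"
proof -
  let ?\<xi> = "\<phi> + \<psi>"
  have support: "set_mset ?\<xi> \<subseteq> space \<eta>" using \<phi> \<psi> by auto
  have "AE z in \<eta>. z \<in> Z \<longrightarrow> z \<in> (\<Union>x\<in>set_mset \<phi>. cell ?\<xi> x)"
    using AE_no_ties[OF support] AE_space
  proof eventually_elim
    case (elim z)
    show ?case
    proof
      assume z: "z \<in> Z"
      obtain x where x: "x \<in># ?\<xi>" "\<And>y. y \<in># ?\<xi> \<Longrightarrow> dist x z \<le> dist y z"
      proof -
        have ne: "finite (set_mset ?\<xi>)" "set_mset ?\<xi> \<noteq> {}" using \<phi>(2) by auto
        from arg_min_if_finite(1)[OF this, of "\<lambda>x. dist x z"] arg_min_least[OF this, of _ "\<lambda>x. dist x z"]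
        show ?thesis by (intro that) auto
      qed
      have "x \<in># \<phi>"
      proof (rule ccontr)
        assume "x \<notin># \<phi>"
        with x(1) have "x \<in># \<psi>" by simp
        from closer[OF z this] x(2) show False by fastforce
      qed
      moreover have "z \<in> cell ?\<xi> x"
        unfolding voronoi_cell_def using elim x \<phi>(1) \<psi> by (auto simp: less_le)
      ultimately show "z \<in> (\<Union>x\<in>set_mset \<phi>. cell ?\<xi> x)" by blast
    qed
  qed
  then have "measure \<eta> Z \<le> measure \<eta> (\<Union>x\<in>set_mset \<phi>. cell ?\<xi> x)"
    by (intro finite_measure_mono_AE) auto
  also have "\<dots> = (\<Sum>x\<in>set_mset \<phi>. measure \<eta> (cell ?\<xi> x))"
    using disjoint_cells[of _ ?\<xi>]
    by (intro finite_measure_finite_Union) (auto simp: disjoint_family_on_def)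
  also have "\<dots> \<le> share \<phi> \<psi>"
    unfolding configuration_share_def by (rule sum_set_mset_le_sum_mset) simp
  finally show ?thesis .
qed

end

section \<open>Expected shares\<close>

lemma num_points_eq_0_iff: "num_points B \<phi> = 0 \<longleftrightarrow> set_mset \<phi> \<inter> B = {}"
  by (induction \<phi>) (auto simp: num_points_def)

lemma config_space_void:
  assumes "B \<in> sets \<mu>"
  shows "{\<phi> \<in> space (config_space \<mu>). set_mset \<phi> \<inter> B = {}} \<in> sets (config_space \<mu>)"
  using measurable_sets[OF num_points_measurable[OF assms], of "{0}"]
  by (simp add: vimage_def Int_def num_points_eq_0_iff conj_commute)

text \<open>The favourable event for an intensity that is supported on two zones.\<close>

definition both_occupied :: "'a set \<Rightarrow> 'a set \<Rightarrow> 'a multiset set" where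
  "both_occupied U1 U2 = {\<phi>. set_mset \<phi> \<subseteq> U1 \<union> U2 \<and> set_mset \<phi> \<inter> U1 \<noteq> {} \<and> set_mset \<phi> \<inter> U2 \<noteq> {}}"

context nonzero_finite_measure
begin

lemma prob_poisson_law: "prob_space (poisson_law \<mu>)"
  by (simp add: poisson_law_eq_sampling_law prob_sampling_law)

lemma sets_poisson_law: "sets (poisson_law \<mu>) = sets (config_space \<mu>)"
  by (simp add: poisson_law_eq_sampling_law sets_sampling_law)

lemma space_poisson_law: "space (poisson_law \<mu>) = {\<phi>. set_mset \<phi> \<subseteq> space \<mu>}"
  by (simp add: poisson_law_eq_sampling_law space_sampling_law)

lemma void_probability:
  assumes "B \<in> sets \<mu>"
  shows "measure (poisson_law \<mu>) {\<phi> \<in> space (poisson_law \<mu>). set_mset \<phi> \<inter> B = {}} = exp (- measure \<mu> B)"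
proof -
  have "measure (poisson_law \<mu>) {\<phi> \<in> space (poisson_law \<mu>). num_points B \<phi> = 0} = exp (- measure \<mu> B)"
    using poisson_point_process_sampling_law assms
    unfolding poisson_law_eq_sampling_law poisson_point_process_def by simp
  then show ?thesis by (simp add: num_points_eq_0_iff)
qed

lemma AE_points_in:
  assumes A: "A \<in> sets \<mu>" and null: "measure \<mu> (space \<mu> - A) = 0"
  shows "AE \<phi> in poisson_law \<mu>. set_mset \<phi> \<subseteq> A"
proof -
  interpret P: prob_space "poisson_law \<mu>" by (rule prob_poisson_law)
  let ?E = "{\<phi> \<in> space (poisson_law \<mu>). set_mset \<phi> \<inter> (space \<mu> - A) = {}}"
  have "?E \<in> P.events"
    using config_space_void[of "space \<mu> - A" \<mu>] A
    by (simp add: sets_poisson_law space_poisson_law space_config_space)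
  moreover have "P.prob ?E = 1"
    using void_probability[of "space \<mu> - A"] A null by simp
  ultimately have "AE \<phi> in poisson_law \<mu>. \<phi> \<in> ?E" using P.AE_in_set_eq_1 by blast
  then show ?thesis by eventually_elim (auto simp: space_poisson_law)
qed

lemma both_occupied:
  assumes U: "U1 \<in> sets \<mu>" "U2 \<in> sets \<mu>" and null: "measure \<mu> (space \<mu> - (U1 \<union> U2)) = 0"
    and c: "c \<le> measure \<mu> U1" "c \<le> measure \<mu> U2"
  shows both_occupied_event: "both_occupied U1 U2 \<in> sets (poisson_law \<mu>)"
    and both_occupied_prob: "1 - 2 * exp (- c) \<le> measure (poisson_law \<mu>) (both_occupied U1 U2)"
proof -
  interpret P: prob_space "poisson_law \<mu>" by (rule prob_poisson_law)
  let ?V = "\<lambda>B. {\<phi> \<in> space (poisson_law \<mu>). set_mset \<phi> \<inter> B = {}}"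
  have V: "?V B \<in> P.events" if "B \<in> sets \<mu>" for B
    using config_space_void[OF that] by (simp add: sets_poisson_law space_poisson_law space_config_space)
  have O: "space \<mu> - (U1 \<union> U2) \<in> sets \<mu>" using U by auto
  have eq: "both_occupied U1 U2 = ?V (space \<mu> - (U1 \<union> U2)) - (?V U1 \<union> ?V U2)"
    using U[THEN sets.sets_into_space] by (auto simp: both_occupied_def space_poisson_law)
  show ev: "both_occupied U1 U2 \<in> P.events" unfolding eq using V U O by auto
  have "P.prob (?V (space \<mu> - (U1 \<union> U2))) = 1" using void_probability[OF O] null by simp
  moreover have "P.prob (?V (space \<mu> - (U1 \<union> U2))) \<le> P.prob (both_occupied U1 U2 \<union> (?V U1 \<union> ?V U2))"
    using V U ev unfolding eq by (intro P.finite_measure_mono) auto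
  moreover have "P.prob (both_occupied U1 U2 \<union> (?V U1 \<union> ?V U2))
      \<le> P.prob (both_occupied U1 U2) + P.prob (?V U1 \<union> ?V U2)"
    using V U ev by (intro measure_Un_le) auto
  moreover have "P.prob (?V U1 \<union> ?V U2) \<le> P.prob (?V U1) + P.prob (?V U2)"
    using V U by (intro measure_Un_le) auto
  moreover have "P.prob (?V U1) \<le> exp (- c)" "P.prob (?V U2) \<le> exp (- c)"
    using void_probability[OF U(1)] void_probability[OF U(2)] c by auto
  ultimately show "1 - 2 * exp (- c) \<le> P.prob (both_occupied U1 U2)" by linarith
qed

end

definition two_zone_intensity :: "'a measure \<Rightarrow> real \<Rightarrow> 'a set \<Rightarrow> 'a set \<Rightarrow> 'a \<Rightarrow> real" where
  "two_zone_intensity \<eta> r U1 U2 x =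
     r / (measure \<eta> U1 + measure \<eta> U2) * (indicator U1 x + indicator U2 x)"

context hotelling_space
begin

abbreviation "process f \<equiv> poisson_law (density \<eta> (\<lambda>x. ennreal (f x)))"

lemma intensity_diffuse:
  assumes f: "f \<in> intensities \<eta> r" and r: "0 < r"
  shows "diffuse_finite_measure (density \<eta> (\<lambda>x. ennreal (f x)))"
proof -
  have [measurable]: "f \<in> borel_measurable \<eta>" using f by (simp add: intensities_def)
  have tot: "emeasure (density \<eta> (\<lambda>x. ennreal (f x))) (space \<eta>) = ennreal r"
    using f by (subst emeasure_density) (auto simp: intensities_def cong: nn_integral_cong_simp)
  interpret finite_measure "density \<eta> (\<lambda>x. ennreal (f x))"
    by (rule finite_measureI) (simp add: tot)
  show ?thesis
  proof unfold_locales
    show "measure (density \<eta> (\<lambda>x. ennreal (f x))) (space (density \<eta> (\<lambda>x. ennreal (f x)))) \<noteq> 0"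
      using tot r by (simp add: measure_def)
    show "(\<lambda>x. x) \<in> borel_measurable (density \<eta> (\<lambda>x. ennreal (f x)))" by measurable
    fix x assume "x \<in> space (density \<eta> (\<lambda>x. ennreal (f x)))"
    then have x: "x \<in> space \<eta>" by simp
    have S: "{x} = {y \<in> space \<eta>. dist x y = 0}" using x by auto
    have "{x} \<in> sets \<eta>" by (subst S) measurable
    then have "{x} \<in> null_sets \<eta>" using null_singleton[OF x] by auto
    moreover have "null_sets \<eta> \<subseteq> null_sets (density \<eta> (\<lambda>x. ennreal (f x)))"
      using absolutely_continuousI_density[of "\<lambda>x. ennreal (f x)" \<eta>] by (simp add: absolutely_continuous_def)
    ultimately show "emeasure (density \<eta> (\<lambda>x. ennreal (f x))) {x} = 0" by auto
  qed
qed

lemma process: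
  assumes f: "f \<in> intensities \<eta> r" and r: "0 < r"
  shows prob_process: "prob_space (process f)"
    and sets_process: "sets (process f) = sets (config_space \<eta>)"
    and AE_process_simple: "AE \<phi> in process f. simple_configuration \<phi>"
proof -
  interpret diffuse_finite_measure "density \<eta> (\<lambda>x. ennreal (f x))" by (rule intensity_diffuse[OF f r])
  show "prob_space (process f)" by (rule prob_poisson_law)
  show "sets (process f) = sets (config_space \<eta>)"
    using config_space_cong[of "density \<eta> (\<lambda>x. ennreal (f x))" \<eta>] by (simp add: sets_poisson_law)
  show "AE \<phi> in process f. simple_configuration \<phi>" by (rule AE_simple_configuration)
qed

lemma expected_share_altdef:
  "expected_share \<eta> f g = (\<integral>\<omega>. share (fst \<omega>) (snd \<omega>) \<partial>(process f \<Otimes>\<^sub>M process g))"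
  by (simp add: expected_share_def configuration_share_def)

lemma share_measurable_process:
  assumes f: "f \<in> intensities \<eta> r" and g: "g \<in> intensities \<eta> r" and r: "0 < r"
  shows "(\<lambda>\<omega>. share (fst \<omega>) (snd \<omega>)) \<in> borel_measurable (process f \<Otimes>\<^sub>M process g)"
    and "(\<lambda>\<omega>. share (snd \<omega>) (fst \<omega>)) \<in> borel_measurable (process f \<Otimes>\<^sub>M process g)"
proof -
  have S: "sets (process f \<Otimes>\<^sub>M process g) = sets (config_space \<eta> \<Otimes>\<^sub>M config_space \<eta>)"
    by (intro sets_pair_measure_cong sets_process[OF f r] sets_process[OF g r])
  show "(\<lambda>\<omega>. share (fst \<omega>) (snd \<omega>)) \<in> borel_measurable (process f \<Otimes>\<^sub>M process g)"
    using share_measurable by (simp add: measurable_cong_sets[OF S refl])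
  have "(\<lambda>\<omega>. (snd \<omega>, fst \<omega>)) \<in> measurable (config_space \<eta> \<Otimes>\<^sub>M config_space \<eta>) (config_space \<eta> \<Otimes>\<^sub>M config_space \<eta>)"
    by measurable
  from measurable_compose[OF this share_measurable]
  show "(\<lambda>\<omega>. share (snd \<omega>) (fst \<omega>)) \<in> borel_measurable (process f \<Otimes>\<^sub>M process g)"
    by (simp add: measurable_cong_sets[OF S refl])
qed

lemma AE_process_pair:
  assumes f: "f \<in> intensities \<eta> r" and g: "g \<in> intensities \<eta> r" and r: "0 < r"
  shows "(AE \<phi> in process f. Q \<phi>) \<Longrightarrow> AE \<omega> in process f \<Otimes>\<^sub>M process g. Q (fst \<omega>)"
    and "(AE \<psi> in process g. Q \<psi>) \<Longrightarrow> AE \<omega> in process f \<Otimes>\<^sub>M process g. Q (snd \<omega>)"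
  using prob_process[OF f r] prob_process[OF g r]
  by (auto intro!: AE_pair_fst AE_pair_snd intro: prob_space_imp_sigma_finite)

lemma share_integrable:
  assumes f: "f \<in> intensities \<eta> r" and g: "g \<in> intensities \<eta> r" and r: "0 < r"
  shows "integrable (process f \<Otimes>\<^sub>M process g) (\<lambda>\<omega>. share (fst \<omega>) (snd \<omega>))"
    and "integrable (process f \<Otimes>\<^sub>M process g) (\<lambda>\<omega>. share (snd \<omega>) (fst \<omega>))"
proof -
  interpret F: prob_space "process f" by (rule prob_process[OF f r])
  interpret G: prob_space "process g" by (rule prob_process[OF g r])
  interpret FG: pair_prob_space "process f" "process g" by unfold_locales
  show "integrable (process f \<Otimes>\<^sub>M process g) (\<lambda>\<omega>. share (fst \<omega>) (snd \<omega>))"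
    using AE_process_pair(1)[OF f g r AE_process_simple[OF f r]] share_measurable_process(1)[OF f g r]
    by (intro FG.integrable_const_bound[where B="measure \<eta> (space \<eta>)"])
      (auto simp: configuration_share_nonneg intro: share_le elim!: eventually_mono)
  show "integrable (process f \<Otimes>\<^sub>M process g) (\<lambda>\<omega>. share (snd \<omega>) (fst \<omega>))"
    using AE_process_pair(2)[OF f g r AE_process_simple[OF g r]] share_measurable_process(2)[OF f g r]
    by (intro FG.integrable_const_bound[where B="measure \<eta> (space \<eta>)"])
      (auto simp: configuration_share_nonneg intro: share_le elim!: eventually_mono)
qed

lemma AE_process_support:
  assumes f: "f \<in> intensities \<eta> r" and r: "0 < r"
    and A: "A \<in> sets \<eta>" and off: "\<And>x. x \<in> space \<eta> - A \<Longrightarrow> f x = 0"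
  shows "measure (density \<eta> (\<lambda>x. ennreal (f x))) (space \<eta> - A) = 0"
    and "AE \<phi> in process f. set_mset \<phi> \<subseteq> A"
proof -
  interpret diffuse_finite_measure "density \<eta> (\<lambda>x. ennreal (f x))" by (rule intensity_diffuse[OF f r])
  have [measurable]: "f \<in> borel_measurable \<eta>" using f by (simp add: intensities_def)
  have "emeasure (density \<eta> (\<lambda>x. ennreal (f x))) (space \<eta> - A)
      = (\<integral>\<^sup>+x. ennreal (f x) * indicator (space \<eta> - A) x \<partial>\<eta>)"
    using A by (intro emeasure_density) auto
  also have "\<dots> = (\<integral>\<^sup>+x. 0 \<partial>\<eta>)"
    using off by (intro nn_integral_cong) (auto simp: indicator_def)
  finally show 0: "measure (density \<eta> (\<lambda>x. ennreal (f x))) (space \<eta> - A) = 0"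
    by (simp add: measure_def)
  show "AE \<phi> in process f. set_mset \<phi> \<subseteq> A"
    using AE_points_in[of A] A 0 by simp
qed

text \<open>Almost surely no point is multiple and no point belongs to both players, so the open cells are disjoint
and their masses add up to at most the total mass. Integrability of the shares rests on the same bound.\<close>

lemma expected_share_add_le:
  assumes f: "f \<in> intensities \<eta> r" and g: "g \<in> intensities \<eta> r" and r: "0 < r"
    and A: "A \<in> sets \<eta>" "\<And>x. x \<in> space \<eta> - A \<Longrightarrow> f x = 0"
    and B: "B \<in> sets \<eta>" "\<And>x. x \<in> space \<eta> - B \<Longrightarrow> g x = 0"
    and AB: "A \<inter> B = {}"
  shows "expected_share \<eta> f g + expected_share \<eta> g f \<le> measure \<eta> (space \<eta>)"
proof -
  interpret F: prob_space "process f" by (rule prob_process[OF f r])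
  interpret G: prob_space "process g" by (rule prob_process[OF g r])
  interpret FG: pair_prob_space "process f" "process g" by unfold_locales
  have supp: "AE \<phi> in process f. set_mset \<phi> \<subseteq> A" "AE \<psi> in process g. set_mset \<psi> \<subseteq> B"
    using A B by (intro AE_process_support(2)[OF f r] AE_process_support(2)[OF g r]; blast)+
  have "expected_share \<eta> g f = (\<integral>\<omega>. share (snd \<omega>) (fst \<omega>) \<partial>(process f \<Otimes>\<^sub>M process g))"
    unfolding expected_share_altdef
    using FG.integral_product_swap[OF share_measurable_process(2)[OF f g r]]
    by (simp add: case_prod_unfold)
  then have "expected_share \<eta> f g + expected_share \<eta> g f
     = (\<integral>\<omega>. share (fst \<omega>) (snd \<omega>) + share (snd \<omega>) (fst \<omega>) \<partial>(process f \<Otimes>\<^sub>M process g))"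
    using share_integrable[OF f g r] by (simp add: expected_share_altdef)
  also have "\<dots> \<le> (\<integral>\<omega>. measure \<eta> (space \<eta>) \<partial>(process f \<Otimes>\<^sub>M process g))"
  proof (rule integral_mono_AE)
    show "AE \<omega> in process f \<Otimes>\<^sub>M process g.
        share (fst \<omega>) (snd \<omega>) + share (snd \<omega>) (fst \<omega>) \<le> measure \<eta> (space \<eta>)"
      using AE_process_pair(1)[OF f g r AE_process_simple[OF f r]]
        AE_process_pair(2)[OF f g r AE_process_simple[OF g r]]
        AE_process_pair(1)[OF f g r supp(1)]
        AE_process_pair(2)[OF f g r supp(2)]
    proof eventually_elim
      case (elim \<omega>)
      with AB show ?case by (intro share_add_le) auto
    qed
  qed (use share_integrable[OF f g r] in auto)
  also have "\<dots> = measure \<eta> (space \<eta>)" by (simp add: FG.prob_space)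
  finally show ?thesis .
qed

lemma expected_share_ge:
  assumes f: "f \<in> intensities \<eta> r" and g: "g \<in> intensities \<eta> r" and r: "0 < r"
    and E: "E1 \<in> sets (process f)" "E2 \<in> sets (process g)"
    and m: "\<And>\<phi> \<psi>. \<phi> \<in> E1 \<Longrightarrow> \<psi> \<in> E2 \<Longrightarrow> m \<le> share \<phi> \<psi>"
  shows "m * (measure (process f) E1 * measure (process g) E2) \<le> expected_share \<eta> f g"
proof -
  interpret F: prob_space "process f" by (rule prob_process[OF f r])
  interpret G: prob_space "process g" by (rule prob_process[OF g r])
  interpret FG: pair_prob_space "process f" "process g" by unfold_locales
  have E12: "E1 \<times> E2 \<in> sets (process f \<Otimes>\<^sub>M process g)" using E by simp
  have "measure (process f \<Otimes>\<^sub>M process g) (E1 \<times> E2) = measure (process f) E1 * measure (process g) E2"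
    using E by (simp add: measure_def G.emeasure_pair_measure_Times enn2real_mult)
  then have "m * (measure (process f) E1 * measure (process g) E2)
     = (\<integral>\<omega>. m * indicator (E1 \<times> E2) \<omega> \<partial>(process f \<Otimes>\<^sub>M process g))"
    using E12 sets.sets_into_space[OF E12] by (simp add: Int_absorb2)
  also have "\<dots> \<le> expected_share \<eta> f g"
    unfolding expected_share_altdef
  proof (rule integral_mono)
    show "integrable (process f \<Otimes>\<^sub>M process g) (\<lambda>\<omega>. m * indicator (E1 \<times> E2) \<omega>)"
      using E12 by (intro integrable_mult_right FG.integrable_const_bound[where B=1]) (auto simp: indicator_def)
    show "m * indicator (E1 \<times> E2) \<omega> \<le> share (fst \<omega>) (snd \<omega>)" for \<omega>
      using m configuration_share_nonneg by (auto simp: indicator_def)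
  qed (rule share_integrable(1)[OF f g r])
  finally show ?thesis .
qed

lemma two_zone_intensity:
  assumes U: "U1 \<in> sets \<eta>" "U2 \<in> sets \<eta>" "measure \<eta> U1 = u" "measure \<eta> U2 = u"
    and u: "0 < u" and r: "0 < r"
  shows two_zone_intensities: "two_zone_intensity \<eta> r U1 U2 \<in> intensities \<eta> r"
    and two_zone_mass: "r / 2 \<le> measure (density \<eta> (\<lambda>x. ennreal (two_zone_intensity \<eta> r U1 U2 x))) U1"
      "r / 2 \<le> measure (density \<eta> (\<lambda>x. ennreal (two_zone_intensity \<eta> r U1 U2 x))) U2"
proof -
  let ?f = "two_zone_intensity \<eta> r U1 U2"
  let ?\<kappa> = "r / (2 * u)"
  have f: "?f x = ?\<kappa> * indicator U1 x + ?\<kappa> * indicator U2 x" for x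
    by (simp add: two_zone_intensity_def U algebra_simps add_divide_distrib)
  have f': "ennreal (?f x) = ennreal ?\<kappa> * indicator U1 x + ennreal ?\<kappa> * indicator U2 x" for x
    using r u unfolding f by (auto simp: indicator_def ennreal_plus[symmetric] simp del: ennreal_plus)
  have e: "ennreal ?\<kappa> * emeasure \<eta> U1 = ennreal (r / 2)" "ennreal ?\<kappa> * emeasure \<eta> U2 = ennreal (r / 2)"
    using U u r by (simp_all add: emeasure_eq_measure ennreal_mult[symmetric])
  have [measurable]: "?f \<in> borel_measurable \<eta>"
    unfolding f[abs_def] using U by measurable
  have "(\<integral>\<^sup>+x. ennreal (?f x) \<partial>\<eta>) = ennreal r"
    unfolding f' using U e r
    by (subst nn_integral_add) (auto simp: nn_integral_cmult_indicator ennreal_plus[symmetric] simp del: ennreal_plus)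
  then show F: "?f \<in> intensities \<eta> r" using r u by (simp add: intensities_def f)
  interpret diffuse_finite_measure "density \<eta> (\<lambda>x. ennreal (?f x))" by (rule intensity_diffuse[OF F r])
  have "r / 2 \<le> measure (density \<eta> (\<lambda>x. ennreal (?f x))) V" if V: "V = U1 \<or> V = U2" for V
  proof -
    have [measurable]: "V \<in> sets \<eta>" using V U by auto
    have "ennreal (r / 2) = (\<integral>\<^sup>+x. ennreal ?\<kappa> * indicator V x \<partial>\<eta>)"
      using V U e by (auto simp: nn_integral_cmult_indicator)
    also have "\<dots> \<le> (\<integral>\<^sup>+x. ennreal (?f x) * indicator V x \<partial>\<eta>)"
      using V by (intro nn_integral_mono) (auto simp: f' indicator_def)
    also have "\<dots> = emeasure (density \<eta> (\<lambda>x. ennreal (?f x))) V"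
      by (intro emeasure_density[symmetric]) measurable
    finally show ?thesis by (simp add: emeasure_eq_measure)
  qed
  then show "r / 2 \<le> measure (density \<eta> (\<lambda>x. ennreal (?f x))) U1"
    "r / 2 \<le> measure (density \<eta> (\<lambda>x. ennreal (?f x))) U2" by blast+
qed

lemma two_zone_intensity_off: "x \<in> space \<eta> - (U1 \<union> U2) \<Longrightarrow> two_zone_intensity \<eta> r U1 U2 x = 0"
  by (simp add: two_zone_intensity_def)

text \<open>All four zones are occupied with probability at least \<open>(1 - 2 * exp (- (r / 2)))\<^sup>2\<close>, and then any choice
of one point from each zone of the player beats every point of the opponent throughout \<open>Z\<close>.\<close>

lemma two_zone_share_ge:
  assumes U: "U1 \<in> sets \<eta>" "U2 \<in> sets \<eta>" "measure \<eta> U1 = u" "measure \<eta> U2 = u"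
    and V: "V1 \<in> sets \<eta>" "V2 \<in> sets \<eta>" "measure \<eta> V1 = u" "measure \<eta> V2 = u"
    and u: "0 < u" and r: "0 < r" and small: "2 * exp (- (r / 2)) \<le> 1"
    and Z: "Z \<in> sets \<eta>"
    and closer: "\<And>z x1 x2 y. z \<in> Z \<Longrightarrow> x1 \<in> U1 \<Longrightarrow> x2 \<in> U2 \<Longrightarrow> y \<in> V1 \<union> V2
      \<Longrightarrow> dist x1 z < dist y z \<or> dist x2 z < dist y z"
  shows "measure \<eta> Z * (1 - 2 * exp (- (r / 2)))\<^sup>2
    \<le> expected_share \<eta> (two_zone_intensity \<eta> r U1 U2) (two_zone_intensity \<eta> r V1 V2)"
proof -
  let ?f = "two_zone_intensity \<eta> r U1 U2" and ?g = "two_zone_intensity \<eta> r V1 V2"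
  note f = two_zone_intensities[OF U u r] and g = two_zone_intensities[OF V u r]
  interpret F: diffuse_finite_measure "density \<eta> (\<lambda>x. ennreal (?f x))" by (rule intensity_diffuse[OF f r])
  interpret G: diffuse_finite_measure "density \<eta> (\<lambda>x. ennreal (?g x))" by (rule intensity_diffuse[OF g r])
  let ?q = "1 - 2 * exp (- (r / 2))"
  have nullF: "measure (density \<eta> (\<lambda>x. ennreal (?f x))) (space (density \<eta> (\<lambda>x. ennreal (?f x))) - (U1 \<union> U2)) = 0"
    unfolding space_density
    by (intro AE_process_support(1)[OF f r]) (use U in \<open>auto intro!: two_zone_intensity_off\<close>)
  have nullG: "measure (density \<eta> (\<lambda>x. ennreal (?g x))) (space (density \<eta> (\<lambda>x. ennreal (?g x))) - (V1 \<union> V2)) = 0"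
    unfolding space_density
    by (intro AE_process_support(1)[OF g r]) (use V in \<open>auto intro!: two_zone_intensity_off\<close>)
  have EF: "both_occupied U1 U2 \<in> sets (process ?f)" "?q \<le> measure (process ?f) (both_occupied U1 U2)"
    using U by (intro F.both_occupied[OF _ _ nullF two_zone_mass[OF U u r]]; simp)+
  have EG: "both_occupied V1 V2 \<in> sets (process ?g)" "?q \<le> measure (process ?g) (both_occupied V1 V2)"
    using V by (intro G.both_occupied[OF _ _ nullG two_zone_mass[OF V u r]]; simp)+
  have "?q * ?q \<le> measure (process ?f) (both_occupied U1 U2) * measure (process ?g) (both_occupied V1 V2)"
    using EF(2) EG(2) small by (intro mult_mono) auto
  then have "measure \<eta> Z * ?q\<^sup>2
      \<le> measure \<eta> Z * (measure (process ?f) (both_occupied U1 U2) * measure (process ?g) (both_occupied V1 V2))"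
    by (intro mult_left_mono) (auto simp: power2_eq_square)
  also have "\<dots> \<le> expected_share \<eta> ?f ?g"
  proof (rule expected_share_ge[OF f g r EF(1) EG(1)])
    fix \<phi> \<psi> assume a: "\<phi> \<in> both_occupied U1 U2" "\<psi> \<in> both_occupied V1 V2"
    then obtain x1 x2 where x: "x1 \<in># \<phi>" "x1 \<in> U1" "x2 \<in># \<phi>" "x2 \<in> U2" by (auto simp: both_occupied_def)
    show "measure \<eta> Z \<le> share \<phi> \<psi>"
    proof (rule share_ge[OF _ _ _ Z])
      show "set_mset \<phi> \<subseteq> space \<eta>" "set_mset \<psi> \<subseteq> space \<eta>"
        using a U V by (auto simp: both_occupied_def dest!: sets.sets_into_space)
      show "\<phi> \<noteq> {#}" using x by auto
      fix z y assume zy: "z \<in> Z" "y \<in># \<psi>"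
      then have "y \<in> V1 \<union> V2" using a by (auto simp: both_occupied_def)
      from closer[OF zy(1) x(2) x(4) this] x show "\<exists>x\<in>#\<phi>. dist x z < dist y z" by blast
    qed
  qed
  finally show ?thesis .
qed

end

section \<open>The circle\<close>

definition circle_point :: "real \<Rightarrow> real ^ 2" where
  "circle_point t = vector [cos t, sin t]"

definition circle_arc :: "real \<Rightarrow> real \<Rightarrow> (real ^ 2) set" where
  "circle_arc a b = circle_point ` {a..b}"

lemma dist_circle_point: "(dist (circle_point s) (circle_point t))\<^sup>2 = 2 - 2 * cos (s - t)"
proof -
  have "(dist (circle_point s) (circle_point t))\<^sup>2 = (cos s - cos t)\<^sup>2 + (sin s - sin t)\<^sup>2"
    unfolding dist_norm norm_eq_sqrt_inner
    by (simp add: inner_vec_def sum_2 circle_point_def power2_eq_square)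
  also have "\<dots> = ((cos s)\<^sup>2 + (sin s)\<^sup>2) + ((cos t)\<^sup>2 + (sin t)\<^sup>2) - 2 * (cos s * cos t + sin s * sin t)"
    by (simp add: power2_eq_square algebra_simps)
  finally show ?thesis by (simp add: cos_diff)
qed

text \<open>The factorization of a difference of cosines shows on which side of their bisector a point lies.\<close>

lemma dist_circle_point_diff:
  "(dist (circle_point s) (circle_point t))\<^sup>2 - (dist (circle_point u) (circle_point t))\<^sup>2
     = 4 * (sin (t - (s + u) / 2) * sin ((u - s) / 2))"
proof -
  have "cos (u - t) - cos (s - t) = 2 * (sin (t - (s + u) / 2) * sin ((u - s) / 2))"
  proof -
    have "cos (t - u) - cos (t - s) = 2 * sin (((t - u) + (t - s)) / 2) * sin (((t - s) - (t - u)) / 2)"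
      by (rule cos_diff_cos)
    also have "((t - u) + (t - s)) / 2 = t - (s + u) / 2" by (simp add: field_simps)
    also have "((t - s) - (t - u)) / 2 = (u - s) / 2" by simp
    finally have "cos (t - u) - cos (t - s) = 2 * (sin (t - (s + u) / 2) * sin ((u - s) / 2))"
      by (simp only: mult.assoc)
    moreover have "cos (t - u) = cos (u - t)" "cos (t - s) = cos (s - t)"
      using cos_minus[of "u - t"] cos_minus[of "s - t"] by simp_all
    ultimately show ?thesis by simp
  qed
  then show ?thesis by (simp add: dist_circle_point)
qed

lemma circle_point_closer:
  assumes "0 < u - s" "u - s < 2 * pi" "0 < 2 * t - (s + u)" "2 * t - (s + u) < 2 * pi"
  shows "dist (circle_point u) (circle_point t) < dist (circle_point s) (circle_point t)"
proof -
  have "0 < sin (t - (s + u) / 2) * sin ((u - s) / 2)"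
    using assms by (intro mult_pos_pos sin_gt_zero) (auto simp: field_simps)
  then have "(dist (circle_point u) (circle_point t))\<^sup>2 < (dist (circle_point s) (circle_point t))\<^sup>2"
    using dist_circle_point_diff[of s t u] by simp
  then show ?thesis by (rule power_less_imp_less_base) simp
qed

lemma circle_point_closer':
  assumes "0 < s - u" "s - u < 2 * pi" "0 < s + u - 2 * t" "s + u - 2 * t < 2 * pi"
  shows "dist (circle_point u) (circle_point t) < dist (circle_point s) (circle_point t)"
proof -
  have "dist (circle_point (- a)) (circle_point (- b)) = dist (circle_point a) (circle_point b)" for a b
  proof -
    have "(dist (circle_point (- a)) (circle_point (- b)))\<^sup>2 = (dist (circle_point a) (circle_point b))\<^sup>2"
      unfolding dist_circle_point using cos_minus[of "a - b"] by simp
    then show ?thesis by (rule power2_eq_imp_eq) simp_all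
  qed
  moreover have "dist (circle_point (- u)) (circle_point (- t)) < dist (circle_point (- s)) (circle_point (- t))"
    using assms by (intro circle_point_closer) (auto simp: field_simps)
  ultimately show ?thesis by simp
qed

lemma circle_point_periodic: "circle_point (t + 2 * pi) = circle_point t" "circle_point (t - 2 * pi) = circle_point t"
  by (simp_all add: circle_point_def cos_diff sin_diff)

lemma circle_point_in_sphere: "circle_point t \<in> sphere 0 1"
proof -
  have "norm (circle_point t) = 1"
    unfolding norm_eq_sqrt_inner by (simp add: inner_vec_def sum_2 circle_point_def power2_eq_square[symmetric])
  then show ?thesis by simp
qed

lemma sphere_circle_point:
  assumes "z \<in> sphere (0 :: real ^ 2) 1"
  obtains t where "0 \<le> t" "t < 2 * pi" "z = circle_point t"
proof -
  have "(z $ 1)\<^sup>2 + (z $ 2)\<^sup>2 = 1"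
  proof -
    have "norm z = 1" using assms by simp
    then have "(norm z)\<^sup>2 = 1" by simp
    then show ?thesis unfolding power2_norm_eq_inner by (simp add: inner_vec_def sum_2 power2_eq_square)
  qed
  from sincos_total_2pi[OF this] obtain t where "0 \<le> t" "t < 2 * pi" "z $ 1 = cos t" "z $ 2 = sin t" by blast
  then show ?thesis by (intro that[of t]) (auto simp: circle_point_def vec_eq_iff forall_2)
qed

lemma circle_point_inj:
  assumes "0 \<le> s" "s < 2 * pi" "0 \<le> t" "t < 2 * pi" "circle_point s = circle_point t"
  shows "s = t"
proof -
  have "cos s = cos t" "sin s = sin t"
    using assms(5) by (auto simp: circle_point_def vec_eq_iff forall_2)
  then obtain n :: int where n: "s = t + 2 * pi * n" using sin_cos_eq_iff by blast
  then have "2 * pi * real_of_int n < 2 * pi * 1" "2 * pi * (- 1) < 2 * pi * real_of_int n"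
    using assms(1-4) by linarith+
  then have "real_of_int n < 1" "-1 < real_of_int n"
    using pi_gt_zero by (simp_all only: mult_less_cancel_left_pos)
  then have "n = 0" by linarith
  then show ?thesis using n by simp
qed

lemma continuous_circle_point: "continuous_on A circle_point"
proof -
  have "continuous_on A (\<lambda>t. \<chi> i. circle_point t $ i)"
  proof (rule continuous_on_vec_lambda)
    fix i :: 2 show "continuous_on A (\<lambda>t. circle_point t $ i)"
      using exhaust_2[of i] by (elim disjE; simp add: circle_point_def; intro continuous_intros)
  qed
  then show ?thesis by simp
qed

lemma circle_point_measurable [measurable]: "circle_point \<in> borel_measurable borel"
  by (intro borel_measurable_continuous_onI continuous_circle_point)

lemma space_circle_measure: "space circle_measure = sphere 0 1"
  by (simp add: circle_measure_def space_restrict_space)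

lemma sets_circle_measure: "sets circle_measure = sets (restrict_space borel (sphere 0 1))"
  by (simp add: circle_measure_def)

lemma emeasure_circle_measure:
  assumes "S \<in> sets circle_measure"
  shows "emeasure circle_measure S = emeasure lborel {t \<in> {0..<2 * pi}. circle_point t \<in> S}"
proof -
  have m: "circle_point \<in> measurable (restrict_space lborel {0..<2 * pi}) (restrict_space borel (sphere 0 1))"
    using circle_point_in_sphere
    by (intro measurable_restrict_space3) (auto simp: circle_point_measurable)
  have "emeasure circle_measure S = emeasure (restrict_space lborel {0..<2 * pi})
      (circle_point -` S \<inter> space (restrict_space lborel {0..<2 * pi}))"
    using assms m unfolding circle_measure_def circle_point_def[abs_def] by (subst emeasure_distr) auto
  also have "circle_point -` S \<inter> space (restrict_space lborel {0..<2 * pi}) = {t \<in> {0..<2 * pi}. circle_point t \<in> S}"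
    by (auto simp: space_restrict_space)
  also have "emeasure (restrict_space lborel {0..<2 * pi}) \<dots> = emeasure lborel {t \<in> {0..<2 * pi}. circle_point t \<in> S}"
    by (intro emeasure_restrict_space) auto
  finally show ?thesis .
qed

lemma emeasure_circle_measure_countable:
  assumes "S \<in> sets circle_measure" "countable {t \<in> {0..<2 * pi}. circle_point t \<in> S}"
  shows "emeasure circle_measure S = 0"
  using assms by (simp add: emeasure_circle_measure emeasure_lborel_countable)

lemma emeasure_circle: "emeasure circle_measure (sphere 0 1) = ennreal (2 * pi)"
proof -
  have "{t \<in> {0..<2 * pi}. circle_point t \<in> sphere 0 1} = {0..<2 * pi}"
    using circle_point_in_sphere by blast
  then show ?thesis
    using emeasure_circle_measure[of "sphere 0 1"] sets.top[of circle_measure]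
    by (simp add: space_circle_measure)
qed

lemma circle_arc_sets: "circle_arc a b \<in> sets circle_measure"
proof -
  have "compact (circle_arc a b)" unfolding circle_arc_def
    by (intro compact_continuous_image continuous_circle_point compact_Icc)
  moreover have "circle_arc a b \<subseteq> sphere 0 1" using circle_point_in_sphere by (auto simp: circle_arc_def)
  ultimately show ?thesis
    by (simp add: sets_circle_measure sets_restrict_space_iff borel_compact)
qed

lemma measure_circle_arc:
  assumes "0 \<le> a" "a \<le> b" "b < 2 * pi"
  shows "measure circle_measure (circle_arc a b) = b - a"
proof -
  have "{t \<in> {0..<2 * pi}. circle_point t \<in> circle_arc a b} = {a..b}"
  proof (intro set_eqI iffI)
    fix t assume t: "t \<in> {t \<in> {0..<2 * pi}. circle_point t \<in> circle_arc a b}"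
    then obtain s where s: "s \<in> {a..b}" "circle_point t = circle_point s" by (auto simp: circle_arc_def)
    with t assms have "t = s" by (intro circle_point_inj) auto
    with s show "t \<in> {a..b}" by simp
  qed (use assms in \<open>auto simp: circle_arc_def\<close>)
  then show ?thesis using assms by (simp add: measure_def emeasure_circle_measure circle_arc_sets)
qed

text \<open>The bisector of two points of the circle meets the circle where a sine vanishes, so its parameters lie
in an arithmetic progression.\<close>

lemma null_bisector_circle:
  assumes "x \<in> sphere 0 1" "y \<in> sphere 0 1" "x \<noteq> y"
  shows "countable {t \<in> {0..<2 * pi}. dist x (circle_point t) = dist y (circle_point t)}"
proof -
  obtain a b where a: "0 \<le> a" "a < 2 * pi" "x = circle_point a" and b: "0 \<le> b" "b < 2 * pi" "y = circle_point b"
    using assms sphere_circle_point by metis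
  have "sin ((b - a) / 2) \<noteq> 0"
  proof
    assume "sin ((b - a) / 2) = 0"
    moreover have "- pi < (b - a) / 2" "(b - a) / 2 < pi" using a b by auto
    ultimately have "(b - a) / 2 = 0" using sin_eq_0_pi by blast
    then show False using a b assms by simp
  qed
  then have "{t \<in> {0..<2 * pi}. dist x (circle_point t) = dist y (circle_point t)}
     \<subseteq> range (\<lambda>k::int. (a + b) / 2 + of_int k * pi)"
  proof (intro subsetI)
    fix t assume s: "sin ((b - a) / 2) \<noteq> 0" and "t \<in> {t \<in> {0..<2 * pi}. dist x (circle_point t) = dist y (circle_point t)}"
    then have "sin (t - (a + b) / 2) = 0"
      using dist_circle_point_diff[of a t b] a b by simp
    then obtain k where "t - (a + b) / 2 = of_int k * pi" using sin_zero_iff_int2 by blast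
    then show "t \<in> range (\<lambda>k::int. (a + b) / 2 + of_int k * pi)" by (intro range_eqI[of _ _ k]) simp
  qed
  then show ?thesis by (rule countable_subset) simp
qed

interpretation circle: hotelling_space circle_measure
proof -
  interpret finite_measure circle_measure
    by (rule finite_measureI) (simp add: space_circle_measure emeasure_circle)
  have id [measurable]: "(\<lambda>x. x) \<in> borel_measurable circle_measure"
    unfolding measurable_cong_sets[OF sets_circle_measure refl]
    by (rule measurable_restrict_space1) simp
  show "hotelling_space circle_measure"
  proof unfold_locales
    show "(\<lambda>x. x) \<in> borel_measurable circle_measure" by (rule id)
    fix x :: "real ^ 2" assume x: "x \<in> space circle_measure"
    have S: "{x} = {y \<in> space circle_measure. dist x y = 0}" using x by auto
    have xs: "{x} \<in> sets circle_measure" by (subst S) measurable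
    obtain a where "x = circle_point a" "0 \<le> a" "a < 2 * pi"
      using x sphere_circle_point unfolding space_circle_measure by metis
    then have "{t \<in> {0..<2 * pi}. circle_point t \<in> {x}} \<subseteq> {a}" using circle_point_inj by auto
    then have "countable {t \<in> {0..<2 * pi}. circle_point t \<in> {x}}" by (rule countable_subset) simp
    with xs show "emeasure circle_measure {x} = 0" by (rule emeasure_circle_measure_countable)
    fix y assume y: "y \<in> space circle_measure" "x \<noteq> y"
    have "{t \<in> {0..<2 * pi}. circle_point t \<in> {z \<in> space circle_measure. dist x z = dist y z}}
      = {t \<in> {0..<2 * pi}. dist x (circle_point t) = dist y (circle_point t)}"
      using circle_point_in_sphere by (auto simp: space_circle_measure)
    then have "countable {t \<in> {0..<2 * pi}. circle_point t \<in> {z \<in> space circle_measure. dist x z = dist y z}}"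
      using null_bisector_circle[of x y] x y by (simp add: space_circle_measure)
    then show "emeasure circle_measure {z \<in> space circle_measure. dist x z = dist y z} = 0"
      by (intro emeasure_circle_measure_countable) measurable
  qed
qed

section \<open>Improvement cycles\<close>

definition intensity_class :: "'a measure \<Rightarrow> real \<Rightarrow> ('a \<Rightarrow> real) \<Rightarrow> ('a \<Rightarrow> real) set" where
  "intensity_class \<eta> r f = {g \<in> intensities \<eta> r. AE x in \<eta>. f x = g x}"

lemma intensity_class_action:
  assumes "f \<in> intensities \<eta> r" shows "intensity_class \<eta> r f \<in> hotelling_actions \<eta> r r i"
proof -
  let ?R = "{(f, g). f \<in> intensities \<eta> r \<and> g \<in> intensities \<eta> r \<and> (AE x in \<eta>. f x = g x)}"
  have "?R `` {f} \<in> intensities \<eta> r // ?R" using assms by (rule quotientI)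
  moreover have "?R `` {f} = intensity_class \<eta> r f" using assms by (auto simp: intensity_class_def)
  ultimately show ?thesis by (simp add: hotelling_actions_def cox_actions_def)
qed

text \<open>The choice of a representative in the definition of the values has no effect on the intensity measure.\<close>

lemma density_representative:
  assumes f: "f \<in> intensities \<eta> r"
  shows "density \<eta> (\<lambda>x. ennreal (representative (intensity_class \<eta> r f) x)) = density \<eta> (\<lambda>x. ennreal (f x))"
proof -
  have "f \<in> intensity_class \<eta> r f" using f by (simp add: intensity_class_def)
  then have g: "representative (intensity_class \<eta> r f) \<in> intensity_class \<eta> r f"
    unfolding representative_def by (rule someI[of "\<lambda>f. f \<in> intensity_class \<eta> r _"])
  define g where "g = representative (intensity_class \<eta> r f)"
  have [measurable]: "g \<in> borel_measurable \<eta>" "f \<in> borel_measurable \<eta>" and "AE x in \<eta>. f x = g x"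
    using g f unfolding g_def[symmetric] by (auto simp: intensity_class_def intensities_def)
  then have "density \<eta> (\<lambda>x. ennreal (g x)) = density \<eta> (\<lambda>x. ennreal (f x))"
    by (intro density_cong) (auto elim!: eventually_mono)
  then show ?thesis by (simp add: g_def)
qed

lemma expected_share_representative:
  assumes "f \<in> intensities \<eta> r" "g \<in> intensities \<eta> r"
  shows "expected_share \<eta> (representative (intensity_class \<eta> r f)) (representative (intensity_class \<eta> r g))
    = expected_share \<eta> f g"
  unfolding expected_share_def using assms by (simp add: density_representative)

text \<open>Around a closed cycle of four unilateral moves, each of which improves the value of the moving player,
a potential would increase strictly and yet return to its initial value.\<close>

lemma not_ordinal_potential_game_cycle:
  assumes a: "a \<in> intensities \<eta> r" "a' \<in> intensities \<eta> r"
    and b: "b \<in> intensities \<eta> r" "b' \<in> intensities \<eta> r"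
    and up: "expected_share \<eta> a b < expected_share \<eta> a' b"
      "expected_share \<eta> b a' < expected_share \<eta> b' a'"
      "expected_share \<eta> a' b' < expected_share \<eta> a b'"
      "expected_share \<eta> b' a < expected_share \<eta> b a"
  shows "\<not> ordinal_potential_game 2 (hotelling_actions \<eta> r r) (hotelling_value \<eta>)"
proof
  assume "ordinal_potential_game 2 (hotelling_actions \<eta> r r) (hotelling_value \<eta>)"
  then obtain P :: "(nat \<Rightarrow> ('a \<Rightarrow> real) set) \<Rightarrow> real" where
    potential: "\<forall>i\<in>{1..2}. \<forall>y\<in>PiE {1..2} (hotelling_actions \<eta> r r).
      \<forall>c\<in>hotelling_actions \<eta> r r i. \<forall>d\<in>hotelling_actions \<eta> r r i.
      hotelling_value \<eta> i (y(i := c)) > hotelling_value \<eta> i (y(i := d)) \<longleftrightarrow> P (y(i := c)) > P (y(i := d))"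
    unfolding ordinal_potential_game_def by (elim exE)
  define prof where "prof f g = (\<lambda>_. undefined)(1::nat := intensity_class \<eta> r f, 2 := intensity_class \<eta> r g)"
    for f g :: "'a \<Rightarrow> real"
  have E: "prof f g \<in> PiE {1..2} (hotelling_actions \<eta> r r)"
    if "f \<in> intensities \<eta> r" "g \<in> intensities \<eta> r" for f g
    using intensity_class_action[OF that(1)] intensity_class_action[OF that(2)]
    by (auto simp: prof_def PiE_iff extensional_def)
  have upd: "(prof f g)(1 := intensity_class \<eta> r h) = prof h g" "(prof f g)(2 := intensity_class \<eta> r h) = prof f h"
    for f g h by (simp_all add: prof_def fun_eq_iff)
  have val: "hotelling_value \<eta> 1 (prof f g) = expected_share \<eta> f g"
    "hotelling_value \<eta> 2 (prof f g) = expected_share \<eta> g f"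
    if "f \<in> intensities \<eta> r" "g \<in> intensities \<eta> r" for f g
    using that by (simp_all add: hotelling_value_def prof_def expected_share_representative)
  have P1: "P (prof f g) < P (prof h g)" if less: "expected_share \<eta> f g < expected_share \<eta> h g"
    and in1: "f \<in> intensities \<eta> r" "g \<in> intensities \<eta> r" "h \<in> intensities \<eta> r" for f g h
    using bspec[OF bspec[OF bspec[OF bspec[OF potential, of 1] E[OF in1(1,2)]]
        intensity_class_action[OF in1(3)]] intensity_class_action[OF in1(1)]]
      less in1 by (simp only: upd val) simp
  have P2: "P (prof f g) < P (prof f h)" if less: "expected_share \<eta> g f < expected_share \<eta> h f"
    and in2: "f \<in> intensities \<eta> r" "g \<in> intensities \<eta> r" "h \<in> intensities \<eta> r" for f g h
    using bspec[OF bspec[OF bspec[OF bspec[OF potential, of 2] E[OF in2(1,2)]]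
        intensity_class_action[OF in2(3)]] intensity_class_action[OF in2(2)]]
      less in2 by (simp only: upd val) simp
  have "P (prof a b) < P (prof a' b)" using a b up(1) by (intro P1)
  also have "\<dots> < P (prof a' b')" using a b up(2) by (intro P2)
  also have "\<dots> < P (prof a b')" using a b up(3) by (intro P1)
  also have "\<dots> < P (prof a b)" using a b up(4) by (intro P2)
  finally show False .
qed

section \<open>Clusters against flanks\<close>

text \<open>A cluster occupies one small arc, cut into two zones at its midpoint \<open>\<alpha>\<close> only so that clusters and
flanks are instances of the same two-zone pattern. The centres used below are \<open>pi / 2\<close> and \<open>3 * pi / 2\<close>,
for which all arcs stay inside the parameter interval from \<open>0\<close> to \<open>2 * pi\<close>.\<close>

definition cluster :: "real \<Rightarrow> real \<Rightarrow> real ^ 2 \<Rightarrow> real" where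
  "cluster r \<alpha> = two_zone_intensity circle_measure r (circle_arc (\<alpha> - pi / 12) \<alpha>) (circle_arc \<alpha> (\<alpha> + pi / 12))"

definition flanks :: "real \<Rightarrow> real \<Rightarrow> real ^ 2 \<Rightarrow> real" where
  "flanks r \<alpha> = two_zone_intensity circle_measure r
     (circle_arc (\<alpha> - pi / 4) (\<alpha> - pi / 6)) (circle_arc (\<alpha> + pi / 6) (\<alpha> + pi / 4))"

lemma circle_arc_mono: "c \<le> a \<Longrightarrow> b \<le> d \<Longrightarrow> circle_arc a b \<subseteq> circle_arc c d"
  by (auto simp: circle_arc_def)

lemma measure_circle: "measure circle_measure (space circle_measure) = 2 * pi"
  by (simp add: measure_def space_circle_measure emeasure_circle)

lemma measure_zone:
  assumes "pi / 2 \<le> \<alpha>" "\<alpha> \<le> 3 * pi / 2"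
  shows "measure circle_measure (circle_arc (\<alpha> - pi / 12) \<alpha>) = pi / 12"
    and "measure circle_measure (circle_arc \<alpha> (\<alpha> + pi / 12)) = pi / 12"
    and "measure circle_measure (circle_arc (\<alpha> - pi / 4) (\<alpha> - pi / 6)) = pi / 12"
    and "measure circle_measure (circle_arc (\<alpha> + pi / 6) (\<alpha> + pi / 4)) = pi / 12"
    and "measure circle_measure (circle_arc (\<alpha> - pi / 6) (\<alpha> + pi / 6)) = pi / 3"
    and "measure circle_measure (circle_arc (\<alpha> - pi / 4) (\<alpha> + pi / 4)) = pi / 2"
  using assms pi_gt_zero by (subst measure_circle_arc; linarith)+

text \<open>One point on either side of the cluster suffices: whatever lies outside the arc of radius \<open>pi / 6\<close> around
the cluster is nearer to the flanking point on its own side, up to the antipode of \<open>\<alpha>\<close>, than to the cluster.\<close>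

lemma flanks_beat_cluster:
  assumes \<alpha>: "pi / 2 \<le> \<alpha>" "\<alpha> \<le> 3 * pi / 2" and r: "0 < r" and small: "2 * exp (- (r / 2)) \<le> 1"
  shows "5 * pi / 3 * (1 - 2 * exp (- (r / 2)))\<^sup>2 \<le> expected_share circle_measure (flanks r \<alpha>) (cluster r \<alpha>)"
proof -
  let ?Z = "space circle_measure - circle_arc (\<alpha> - pi / 6) (\<alpha> + pi / 6)"
  have "measure circle_measure ?Z = 2 * pi - pi / 3"
    using circle.finite_measure_compl[OF circle_arc_sets] by (simp only: measure_circle measure_zone[OF \<alpha>])
  then have Z: "measure circle_measure ?Z = 5 * pi / 3" by simp
  have "measure circle_measure ?Z * (1 - 2 * exp (- (r / 2)))\<^sup>2 \<le> expected_share circle_measure (flanks r \<alpha>) (cluster r \<alpha>)"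
    unfolding flanks_def cluster_def
  proof (rule circle.two_zone_share_ge[where u="pi / 12"])
    fix z x1 x2 y
    assume z: "z \<in> ?Z" and x: "x1 \<in> circle_arc (\<alpha> - pi / 4) (\<alpha> - pi / 6)" "x2 \<in> circle_arc (\<alpha> + pi / 6) (\<alpha> + pi / 4)"
      and y: "y \<in> circle_arc (\<alpha> - pi / 12) \<alpha> \<union> circle_arc \<alpha> (\<alpha> + pi / 12)"
    have "circle_arc (\<alpha> - pi / 12) \<alpha> \<subseteq> circle_arc (\<alpha> - pi / 12) (\<alpha> + pi / 12)"
      "circle_arc \<alpha> (\<alpha> + pi / 12) \<subseteq> circle_arc (\<alpha> - pi / 12) (\<alpha> + pi / 12)"
      by (rule circle_arc_mono; use pi_gt_zero in linarith)+
    then obtain s where s: "y = circle_point s" "\<alpha> - pi / 12 \<le> s" "s \<le> \<alpha> + pi / 12"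
      using y by (auto simp: circle_arc_def)
    obtain v1 where v1: "x1 = circle_point v1" "\<alpha> - pi / 4 \<le> v1" "v1 \<le> \<alpha> - pi / 6"
      using x(1) by (auto simp: circle_arc_def)
    obtain v2 where v2: "x2 = circle_point v2" "\<alpha> + pi / 6 \<le> v2" "v2 \<le> \<alpha> + pi / 4"
      using x(2) by (auto simp: circle_arc_def)
    obtain t where t: "0 \<le> t" "t < 2 * pi" "z = circle_point t"
      using z sphere_circle_point by (auto simp: space_circle_measure)
    have t': "t < \<alpha> - pi / 6 \<or> \<alpha> + pi / 6 < t" using z t(3) by (force simp: circle_arc_def)
    have right: "dist x2 z < dist y z" if "z = circle_point q" "\<alpha> + pi / 6 < q" "q \<le> \<alpha> + pi" for q
      unfolding v2(1) s(1) that(1)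
      by (rule circle_point_closer) (use v2(2,3) s(2,3) that(2,3) pi_gt_zero in linarith)+
    have left: "dist x1 z < dist y z" if "z = circle_point q" "\<alpha> - pi \<le> q" "q < \<alpha> - pi / 6" for q
      unfolding v1(1) s(1) that(1)
      by (rule circle_point_closer') (use v1(2,3) s(2,3) that(2,3) pi_gt_zero in linarith)+
    \<comment> \<open>The parameter \<open>t\<close> is shifted by a full turn where necessary to lie within \<open>pi\<close> of \<open>\<alpha>\<close>.\<close>
    consider "\<alpha> + pi / 6 < t" "t \<le> \<alpha> + pi" | "\<alpha> + pi < t" | "\<alpha> - pi \<le> t" "t < \<alpha> - pi / 6" | "t < \<alpha> - pi"
      using t' by linarith
    then show "dist x1 z < dist y z \<or> dist x2 z < dist y z"
    proof cases
      case 1 then show ?thesis using right[OF t(3)] by simp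
    next
      case 2
      have "dist x1 z < dist y z"
        using 2 t \<alpha> by (intro left[of "t - 2 * pi"]) (auto simp: circle_point_periodic)
      then show ?thesis ..
    next
      case 3 then show ?thesis using left[OF t(3)] by simp
    next
      case 4
      have "dist x2 z < dist y z"
        using 4 t \<alpha> by (intro right[of "t + 2 * pi"]) (auto simp: circle_point_periodic)
      then show ?thesis ..
    qed
  qed (use \<alpha> r small in \<open>auto simp: circle_arc_sets measure_zone\<close>)
  then show ?thesis unfolding Z .
qed

text \<open>Seen from the antipode, the two flanks lie close together and no longer enclose the cluster, which
wins a quarter of the circle around itself.\<close>

lemma opposite_cluster_share:
  assumes \<alpha>: "pi / 2 \<le> \<alpha>" "\<alpha> \<le> 3 * pi / 2" and \<beta>: "pi / 2 \<le> \<beta>" "\<beta> \<le> 3 * pi / 2"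
    and opposite: "\<beta> = \<alpha> + pi \<or> \<alpha> = \<beta> + pi"
    and r: "0 < r" and small: "2 * exp (- (r / 2)) \<le> 1"
  shows "pi / 2 * (1 - 2 * exp (- (r / 2)))\<^sup>2 \<le> expected_share circle_measure (cluster r \<alpha>) (flanks r \<beta>)"
proof -
  let ?Z = "circle_arc (\<alpha> - pi / 4) (\<alpha> + pi / 4)"
  have "measure circle_measure ?Z * (1 - 2 * exp (- (r / 2)))\<^sup>2 \<le> expected_share circle_measure (cluster r \<alpha>) (flanks r \<beta>)"
    unfolding flanks_def cluster_def
  proof (rule circle.two_zone_share_ge[where u="pi / 12"])
    fix z x1 x2 y
    assume z: "z \<in> ?Z" and x1: "x1 \<in> circle_arc (\<alpha> - pi / 12) \<alpha>"
      and y: "y \<in> circle_arc (\<beta> - pi / 4) (\<beta> - pi / 6) \<union> circle_arc (\<beta> + pi / 6) (\<beta> + pi / 4)"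
    have "circle_arc (\<beta> - pi / 4) (\<beta> - pi / 6) \<subseteq> circle_arc (\<beta> - pi / 4) (\<beta> + pi / 4)"
      "circle_arc (\<beta> + pi / 6) (\<beta> + pi / 4) \<subseteq> circle_arc (\<beta> - pi / 4) (\<beta> + pi / 4)"
      by (rule circle_arc_mono; use pi_gt_zero in linarith)+
    then obtain v where v: "y = circle_point v" "\<beta> - pi / 4 \<le> v" "v \<le> \<beta> + pi / 4"
      using y by (auto simp: circle_arc_def)
    obtain t where t: "z = circle_point t" "\<alpha> - pi / 4 \<le> t" "t \<le> \<alpha> + pi / 4"
      using z by (auto simp: circle_arc_def)
    obtain s where s: "x1 = circle_point s" "\<alpha> - pi / 12 \<le> s" "s \<le> \<alpha>"
      using x1 by (auto simp: circle_arc_def)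
    from opposite have "dist x1 z < dist y z"
    proof
      assume rel: "\<beta> = \<alpha> + pi"
      show ?thesis unfolding t(1) s(1) v(1)
        by (rule circle_point_closer') (use t(2,3) s(2,3) v(2,3) rel pi_gt_zero in linarith)+
    next
      assume rel: "\<alpha> = \<beta> + pi"
      show ?thesis unfolding t(1) s(1) v(1)
        by (rule circle_point_closer) (use t(2,3) s(2,3) v(2,3) rel pi_gt_zero in linarith)+
    qed
    then show "dist x1 z < dist y z \<or> dist x2 z < dist y z" ..
  qed (use \<alpha> \<beta> r small in \<open>auto simp: circle_arc_sets measure_zone\<close>)
  then show ?thesis by (simp only: measure_zone[OF \<alpha>])
qed

lemma disjoint_circle_arcs:
  assumes "0 \<le> a" "b < c" "d < 2 * pi"
  shows "circle_arc a b \<inter> circle_arc c d = {}" "circle_arc c d \<inter> circle_arc a b = {}"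
proof -
  have False if "s \<in> {a..b}" "t \<in> {c..d}" "circle_point s = circle_point t" for s t
    using circle_point_inj[of s t] that assms by auto
  then show "circle_arc a b \<inter> circle_arc c d = {}" by (fastforce simp: circle_arc_def)
  then show "circle_arc c d \<inter> circle_arc a b = {}" by blast
qed

lemma cluster_intensity:
  assumes "pi / 2 \<le> \<alpha>" "\<alpha> \<le> 3 * pi / 2" "0 < r"
  shows "cluster r \<alpha> \<in> intensities circle_measure r"
  unfolding cluster_def using assms
  by (intro circle.two_zone_intensities[where u="pi / 12"]) (auto simp: circle_arc_sets measure_zone)

lemma flanks_intensity:
  assumes "pi / 2 \<le> \<beta>" "\<beta> \<le> 3 * pi / 2" "0 < r"
  shows "flanks r \<beta> \<in> intensities circle_measure r"
  unfolding flanks_def using assms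
  by (intro circle.two_zone_intensities[where u="pi / 12"]) (auto simp: circle_arc_sets measure_zone)

lemma cluster_flanks_add_le:
  assumes \<alpha>: "pi / 2 \<le> \<alpha>" "\<alpha> \<le> 3 * pi / 2" and \<beta>: "pi / 2 \<le> \<beta>" "\<beta> \<le> 3 * pi / 2"
    and rel: "\<beta> = \<alpha> \<or> \<beta> = \<alpha> + pi \<or> \<alpha> = \<beta> + pi" and r: "0 < r"
  shows "expected_share circle_measure (cluster r \<alpha>) (flanks r \<beta>)
      + expected_share circle_measure (flanks r \<beta>) (cluster r \<alpha>) \<le> 2 * pi"
proof -
  let ?A = "circle_arc (\<alpha> - pi / 12) \<alpha> \<union> circle_arc \<alpha> (\<alpha> + pi / 12)"
  let ?B = "circle_arc (\<beta> - pi / 4) (\<beta> - pi / 6) \<union> circle_arc (\<beta> + pi / 6) (\<beta> + pi / 4)"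
  have "circle_arc (\<alpha> - pi / 12) (\<alpha> + pi / 12) \<inter> circle_arc c d = {}"
    if "\<alpha> + pi / 12 < c \<or> d < \<alpha> - pi / 12" "0 \<le> c" "d < 2 * pi" for c d
    using that(1)
  proof
    assume "\<alpha> + pi / 12 < c"
    then show ?thesis by (intro disjoint_circle_arcs(1)) (use \<alpha> that pi_gt_zero in linarith)+
  next
    assume "d < \<alpha> - pi / 12"
    then show ?thesis by (intro disjoint_circle_arcs(2)) (use \<alpha> that pi_gt_zero in linarith)+
  qed
  note disjoint = this
  have gap: "\<alpha> + pi / 12 < \<beta> - pi / 4 \<or> \<beta> - pi / 6 < \<alpha> - pi / 12"
    "\<alpha> + pi / 12 < \<beta> + pi / 6 \<or> \<beta> + pi / 4 < \<alpha> - pi / 12"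
    using rel pi_gt_zero by auto
  have disj: "circle_arc (\<alpha> - pi / 12) (\<alpha> + pi / 12) \<inter> circle_arc (\<beta> - pi / 4) (\<beta> - pi / 6) = {}"
    "circle_arc (\<alpha> - pi / 12) (\<alpha> + pi / 12) \<inter> circle_arc (\<beta> + pi / 6) (\<beta> + pi / 4) = {}"
    by (rule disjoint[OF gap(1)] disjoint[OF gap(2)]; use \<beta> pi_gt_zero in linarith)+
  have "?A \<subseteq> circle_arc (\<alpha> - pi / 12) (\<alpha> + pi / 12)"
    by (intro Un_least; rule circle_arc_mono; use pi_gt_zero in linarith)
  then have AB: "?A \<inter> ?B = {}" using disj by blast
  have "expected_share circle_measure (cluster r \<alpha>) (flanks r \<beta>)
      + expected_share circle_measure (flanks r \<beta>) (cluster r \<alpha>) \<le> measure circle_measure (space circle_measure)"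
    using AB circle_arc_sets
    by (intro circle.expected_share_add_le[OF cluster_intensity[OF \<alpha> r] flanks_intensity[OF \<beta> r] r, of ?A ?B])
      (auto simp: cluster_def flanks_def intro!: circle.two_zone_intensity_off)
  then show ?thesis by (simp only: measure_circle)
qed

theorem mainTheorem6:
  shows "eventually
    (\<lambda>\<rho>::real. \<not> ordinal_potential_game 2
        (hotelling_actions circle_measure (\<rho> / 2) (\<rho> / 2))
        (hotelling_value circle_measure)) at_top"
proof -
  have "((\<lambda>\<rho>::real. 1 - 2 * exp (- (\<rho> / 2 / 2))) \<longlongrightarrow> 1) at_top" by real_asymp
  then have "eventually (\<lambda>\<rho>::real. 49 / 50 < 1 - 2 * exp (- (\<rho> / 2 / 2))) at_top"
    by (rule order_tendstoD) simp
  then show ?thesis using eventually_gt_at_top[of 0]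
  proof eventually_elim
    case (elim \<rho>)
    let ?r = "\<rho> / 2" and ?l = "pi / 2" and ?u = "3 * pi / 2" and ?S = "expected_share circle_measure"
    define p where "p = (1 - 2 * exp (- (?r / 2)))\<^sup>2"
    have r: "0 < ?r" and small: "2 * exp (- (?r / 2)) \<le> 1" using elim by auto
    have "(49 / 50)\<^sup>2 < p" unfolding p_def using elim by (intro power_strict_mono) auto
    \<comment> \<open>The two guaranteed shares sum to \<open>13 * pi / 6 * p\<close>, which exceeds \<open>2 * pi\<close> exactly when \<open>p > 12 / 13\<close>.\<close>
    then have "pi * (12 / 13) < pi * p" by (intro mult_strict_left_mono) (auto simp: power2_eq_square)
    then have p: "2 * pi < 5 * pi / 3 * p + pi / 2 * p" by simp
    have lu: "pi / 2 \<le> ?l" "?l \<le> 3 * pi / 2" "pi / 2 \<le> ?u" "?u \<le> 3 * pi / 2" "?u = ?l + pi"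
      using pi_gt_zero by auto
    note fl = flanks_beat_cluster[OF lu(1,2) r small, folded p_def]
      flanks_beat_cluster[OF lu(3,4) r small, folded p_def]
    have "pi / 2 * p \<le> ?S (cluster ?r ?l) (flanks ?r ?u)" "pi / 2 * p \<le> ?S (cluster ?r ?u) (flanks ?r ?l)"
      unfolding p_def using lu r small by (intro opposite_cluster_share; blast)+
    note op = this
    have "?S (cluster ?r \<alpha>) (flanks ?r \<beta>) + ?S (flanks ?r \<beta>) (cluster ?r \<alpha>) \<le> 2 * pi"
      if "\<alpha> \<in> {?l, ?u}" "\<beta> \<in> {?l, ?u}" for \<alpha> \<beta>
      using that r pi_gt_zero by (intro cluster_flanks_add_le) auto
    note sum = this[OF insertI1 insertI1] this[OF insertI1 insertI2[OF singletonI]]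
      this[OF insertI2[OF singletonI] insertI1] this[OF insertI2[OF singletonI] insertI2[OF singletonI]]
    show ?case
    proof (rule not_ordinal_potential_game_cycle)
      show "cluster ?r ?l \<in> intensities circle_measure ?r" "cluster ?r ?u \<in> intensities circle_measure ?r"
        "flanks ?r ?l \<in> intensities circle_measure ?r" "flanks ?r ?u \<in> intensities circle_measure ?r"
        using lu(1-4) r by (blast intro: cluster_intensity flanks_intensity)+
    qed (use p fl op sum in linarith)+
  qed
qed

end
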